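(* Let $G=(V,E)$ be a digraph with $n$ vertices $v_1,\ldots,v_n$, spectral radius $\rho(G)$, and no sinks. Then for any integers $N\ge0$ and $k\ge0$, \[ \min_{\substack{1\le i,j\le n\\ (v_i,v_j)\in E}}\left(\frac{d_i^{(k+1)+}\,d_j^{(k+N)+}}{d_i^{k+}\,d_j^{k+}}\right)^{\frac{1}{N+1}}\le \rho(G)\le \max_{\substack{1\le i,j\le n\\ (v_i,v_j)\in E}}\left(\frac{d_i^{(k+1)+}\,d_j^{(k+N)+}}{d_i^{k+}\,d_j^{k+}}\right)^{\frac{1}{N+1}}. \] Moreover, if $G$ is strongly connected, then equality holds in this inequality if and only if $G$ is average $(k+1)$-outdegree regular or average $(k+1)$-outdegree $r$-quasiregular (or both), where $r=\gcd(N+1,h(G))$.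
   Context: Digraphs may have self-loops and multiple arcs; $(v_i,v_j)\in E$ means there is at least one arc from $v_i$ to $v_j$. The adjacency matrix $A(G)=(a_{ij})$ has $a_{ij}$ equal to the number of arcs from $v_i$ to $v_j$; $\rho(G)$ is the maximum eigenvalue modulus of $A(G)$. $G$ is strongly connected iff $A(G)$ is irreducible, and then $h(G)$, the index of imprimitivity, is the number of eigenvalues of $A(G)$ of modulus $\rho(G)$. $d_i^{k+}=\sum_j a_{ij}^{(k)}$, with $a_{ij}^{(k)}$ the $(i,j)$ entry of $A(G)^k$, is the number of directed walks of length $k$ starting at $v_i$; $d_i^{0+}=1$. A sink is a vertex with no outgoing arcs. For $\kappa\ge1$, $G$ is average $\kappa$-outdegree regular if $d_i^{\kappa+}/d_i^{(\kappa-1)+}$ is the same constant for all $v_i\in V$. For $r>1$, $G$ is cyclically $r$-partite if $r$ divides $h(G)$; then $V$ is partitioned into nonempty classes $V_1,\ldots,V_r$ such that every arc with initial vertex in $V_j$ has terminal vertex in $V_{(j\bmod r)+1}$. $G$ is average $\kappa$-outdegree $r$-quasiregular if it is cyclically $r$-partite and there are constants $c_1,\ldots,c_r$ with $d_i^{\kappa+}/d_i^{(\kappa-1)+}=c_j$ for all $v_i\in V_j$. *)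

theory Defs
  imports
    Complex_Main
    "HOL-Library.Disjoint_Sets"
    "Graph_Theory.Digraph_Component"
    "Jordan_Normal_Form.Spectral_Radius"
begin

text \<open>
  Digraphs with loops and multiple arcs are the \<^locale>\<open>fin_digraph\<close>s of the library. The vertices
  $v_1, \dots, v_n$ are given by a list \<open>vs\<close> without repetitions, so that $v_i$ is
  \<open>vs ! (i - 1)\<close>; matrix and vertex indices below range over $0, \dots, n - 1$.
\<close>

definition enumerates :: "'a list \<Rightarrow> ('a, 'b) pre_digraph \<Rightarrow> bool" where
  "enumerates vs G \<longleftrightarrow> distinct vs \<and> set vs = verts G"

definition is_sink :: "('a, 'b) pre_digraph \<Rightarrow> 'a \<Rightarrow> bool" where
  "is_sink G u \<longleftrightarrow> u \<in> verts G \<and> \<not> (\<exists>e \<in> arcs G. tail G e = u)"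

definition adj_mat :: "('a, 'b) pre_digraph \<Rightarrow> 'a list \<Rightarrow> nat mat" where
  "adj_mat G vs = mat (length vs) (length vs)
     (\<lambda>(i, j). card {e \<in> arcs G. tail G e = vs ! i \<and> head G e = vs ! j})"

abbreviation complex_adj_mat :: "('a, 'b) pre_digraph \<Rightarrow> 'a list \<Rightarrow> complex mat" where
  "complex_adj_mat G vs \<equiv> map_mat of_nat (adj_mat G vs)"

definition digraph_rho :: "('a, 'b) pre_digraph \<Rightarrow> 'a list \<Rightarrow> real" where
  "digraph_rho G vs = spectral_radius (complex_adj_mat G vs)"

text \<open>
  Eigenvalues are counted with algebraic multiplicity. The notion is only used for strongly
  connected digraphs.
\<close>

definition imprimitivity_index :: "('a, 'b) pre_digraph \<Rightarrow> 'a list \<Rightarrow> nat" where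
  "imprimitivity_index G vs =
     (\<Sum>z \<in> {z \<in> spectrum (complex_adj_mat G vs). cmod z = digraph_rho G vs}.
        Polynomial.order z (char_poly (complex_adj_mat G vs)))"

definition outdeg :: "('a, 'b) pre_digraph \<Rightarrow> 'a list \<Rightarrow> nat \<Rightarrow> nat \<Rightarrow> nat" where
  "outdeg G vs k i = (\<Sum>j < length vs. (adj_mat G vs ^\<^sub>m k) $$ (i, j))"

definition average_outdegree :: "('a, 'b) pre_digraph \<Rightarrow> 'a list \<Rightarrow> nat \<Rightarrow> nat \<Rightarrow> real" where
  "average_outdegree G vs \<kappa> i = real (outdeg G vs \<kappa> i) / real (outdeg G vs (\<kappa> - 1) i)"

definition average_outdegree_regular :: "('a, 'b) pre_digraph \<Rightarrow> 'a list \<Rightarrow> nat \<Rightarrow> bool" where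
  "average_outdegree_regular G vs \<kappa> \<longleftrightarrow>
     1 \<le> \<kappa> \<and> (\<exists>c. \<forall>i < length vs. average_outdegree G vs \<kappa> i = c)"

definition cyclically_partite :: "('a, 'b) pre_digraph \<Rightarrow> 'a list \<Rightarrow> nat \<Rightarrow> bool" where
  "cyclically_partite G vs r \<longleftrightarrow>
     strongly_connected G \<and> 1 < r \<and> r dvd imprimitivity_index G vs"

definition cyclic_classes :: "('a, 'b) pre_digraph \<Rightarrow> nat \<Rightarrow> (nat \<Rightarrow> 'a set) \<Rightarrow> bool" where
  "cyclic_classes G r V \<longleftrightarrow>
     (\<forall>j \<in> {1..r}. V j \<noteq> {}) \<and> disjoint_family_on V {1..r} \<and> (\<Union>j \<in> {1..r}. V j) = verts G \<and>
     (\<forall>e \<in> arcs G. \<forall>j \<in> {1..r}. tail G e \<in> V j \<longrightarrow> head G e \<in> V (j mod r + 1))"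

text \<open>
  In a strongly connected digraph the cyclic classes are determined by \<open>r\<close> up to a rotation of
  their indices, so quantifying over them existentially is harmless.
\<close>

definition average_outdegree_quasiregular ::
    "('a, 'b) pre_digraph \<Rightarrow> 'a list \<Rightarrow> nat \<Rightarrow> nat \<Rightarrow> bool" where
  "average_outdegree_quasiregular G vs \<kappa> r \<longleftrightarrow>
     1 \<le> \<kappa> \<and> cyclically_partite G vs r \<and>
     (\<exists>V c. cyclic_classes G r V \<and>
        (\<forall>j \<in> {1..r}. \<forall>i < length vs. vs ! i \<in> V j \<longrightarrow> average_outdegree G vs \<kappa> i = c j))"

definition arc_value :: "('a, 'b) pre_digraph \<Rightarrow> 'a list \<Rightarrow> nat \<Rightarrow> nat \<Rightarrow> nat \<Rightarrow> nat \<Rightarrow> real" where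
  "arc_value G vs k N i j =
     (real (outdeg G vs (k + 1) i) * real (outdeg G vs (k + N) j) /
      (real (outdeg G vs k i) * real (outdeg G vs k j))) powr (1 / real (N + 1))"

definition arc_values :: "('a, 'b) pre_digraph \<Rightarrow> 'a list \<Rightarrow> nat \<Rightarrow> nat \<Rightarrow> real set" where
  "arc_values G vs k N =
     {arc_value G vs k N i j | i j. i < length vs \<and> j < length vs \<and> vs ! i \<rightarrow>\<^bsub>G\<^esub> vs ! j}"

end

theory Submission
  imports Defs
begin

text \<open>
  Let \<open>A\<close> be the adjacency matrix, \<open>x = A\<^sup>k 1\<close> and \<open>L = N + 1\<close>. If \<open>M\<close> bounds all arc ratios
  \<open>(A x)\<^sub>i (A\<^sup>N x)\<^sub>j / (x\<^sub>i x\<^sub>j)\<close>, then \<open>A\<^sup>L x \<le> M x\<close> entrywise, whence \<open>rho\<^sup>L \<le> M\<close>; the lower bound is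
  similar. For irreducible \<open>A\<close>, an extremal arc ratio \<open>rho\<^sup>L\<close> forces \<open>A\<^sup>L x = rho\<^sup>L x\<close>, so \<open>x\<close> is a sum of
  eigenvectors for eigenvalues \<open>rho \<zeta>\<close> with \<open>\<zeta>\<^sup>L = 1\<close>.

  Every eigenvector for an eigenvalue of modulus \<open>rho\<close> is the Perron vector \<open>p\<close> multiplied by
  unimodular phases \<open>d\<close> with \<open>d\<^sub>j = u d\<^sub>i\<close> along the arcs. Phases multiply, so the normalized peripheral
  eigenvalues \<open>u\<close> form a finite group: they are the \<open>h\<close>-th roots of unity, and they are simple.
  Hence only \<open>\<zeta>\<close> with \<open>\<zeta>\<^sup>r = 1\<close>, \<open>r = gcd L h\<close>, occur in \<open>x\<close>, and \<open>x / p\<close> depends only on the phase for a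
  primitive \<open>r\<close>-th root of unity, whose level sets are the cyclic classes.
\<close>

section \<open>Matrices as kernels\<close>

text \<open>The value type is any real vector space, so one operator acts on real test vectors and
  on complex eigenvectors. Only arguments below \<open>n\<close> are read, which replaces carrier
  conditions.\<close>

definition mv :: "nat \<Rightarrow> (nat \<Rightarrow> nat \<Rightarrow> real) \<Rightarrow> (nat \<Rightarrow> 'b) \<Rightarrow> nat \<Rightarrow> 'b::real_vector" where
  "mv n a f i = (\<Sum>j<n. a i j *\<^sub>R f j)"

definition kmat :: "nat \<Rightarrow> (nat \<Rightarrow> nat \<Rightarrow> real) \<Rightarrow> complex mat" where
  "kmat n a = mat n n (\<lambda>(i, j). of_real (a i j))"

definition eigf :: "nat \<Rightarrow> (nat \<Rightarrow> nat \<Rightarrow> real) \<Rightarrow> complex \<Rightarrow> (nat \<Rightarrow> complex) \<Rightarrow> bool" where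
  "eigf n a l z \<longleftrightarrow> (\<exists>i<n. z i \<noteq> 0) \<and> (\<forall>i<n. mv n a z i = l * z i)"

lemma mv_cong: "(\<And>j. j < n \<Longrightarrow> f j = g j) \<Longrightarrow> mv n a f i = mv n a g i"
  by (simp add: mv_def)

lemma mv_add: "mv n a (\<lambda>i. f i + g i) i = mv n a f i + mv n a g i"
  by (simp add: mv_def scaleR_add_right sum.distrib)

lemma mv_diff: "mv n a (\<lambda>i. f i - g i) i = mv n a f i - mv n a g i"
  by (simp add: mv_def scaleR_diff_right sum_subtractf)

lemma mv_mult: "mv n a (\<lambda>i. c * f i) i = c * (mv n a f i :: 'b :: real_algebra_1)"
  by (simp add: mv_def sum_distrib_left)

lemma mv_sum: "mv n a (\<lambda>i. \<Sum>s\<in>S. f s i) i = (\<Sum>s\<in>S. mv n a (f s) i)"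
  unfolding mv_def by (subst sum.swap) (simp add: scaleR_sum_right)

lemma mv_of_real: "mv n a (\<lambda>i. of_real (f i) :: complex) i = of_real (mv n a f i)"
  by (simp add: mv_def scaleR_conv_of_real)

lemma mv_pow_mult: "(mv n a ^^ k) (\<lambda>i. c * f i) = (\<lambda>i. c * ((mv n a ^^ k) f i :: 'b :: real_algebra_1))"
  by (induction k) (auto simp: mv_mult)

lemma mv_pow_diff: "(mv n a ^^ k) (\<lambda>i. f i - g i) = (\<lambda>i. (mv n a ^^ k) f i - (mv n a ^^ k) g i)"
  by (induction k) (auto simp: mv_diff)

lemma mv_pow_sum:
  "(mv n a ^^ k) (\<lambda>i. \<Sum>s\<in>S. f s i) = (\<lambda>i. \<Sum>s\<in>S. (mv n a ^^ k) (f s) i)"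
  by (induction k) (auto simp: mv_sum)

lemma mv_pow_of_real:
  "(mv n a ^^ k) (\<lambda>i. of_real (f i) :: complex) = (\<lambda>i. of_real ((mv n a ^^ k) f i))"
  by (induction k) (auto simp: mv_of_real)

lemma mv_pow_eig:
  assumes "\<And>i. i < n \<Longrightarrow> mv n a f i = c * (f i :: 'b :: real_algebra_1)" "i < n"
  shows "(mv n a ^^ k) f i = c ^ k * f i"
  using assms(2)
proof (induction k arbitrary: i)
  case (Suc k)
  have "(mv n a ^^ Suc k) f i = mv n a (\<lambda>i. c ^ k * f i) i"
    using Suc.IH by (auto intro: mv_cong)
  then show ?case
    using assms(1)[OF Suc.prems] by (simp add: mv_mult power_commutes flip: mult.assoc)
qed simp

lemma kmat_carrier [simp]: "kmat n a \<in> carrier_mat n n"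
  by (simp add: kmat_def)

lemma kmat_mult_vec: "kmat n a *\<^sub>v vec n f = vec n (mv n a f)"
  by (auto simp: kmat_def mv_def scalar_prod_def scaleR_conv_of_real atLeast0LessThan
      intro!: eq_vecI sum.cong)

lemma kmat_pow_mult_vec: "(kmat n a ^\<^sub>m k) *\<^sub>v vec n f = vec n ((mv n a ^^ k) f)"
proof (induction k arbitrary: f)
  case 0
  then show ?case by (auto simp: kmat_def)
next
  case (Suc k)
  have "(kmat n a ^\<^sub>m Suc k) *\<^sub>v vec n f = (kmat n a ^\<^sub>m k) *\<^sub>v (kmat n a *\<^sub>v vec n f)"
    by (simp add: assoc_mult_mat_vec[of _ n n _ n])
  then show ?case
    by (simp only: kmat_mult_vec Suc funpow_Suc_right o_apply)
qed

lemma eigenvalue_kmat: "eigenvalue (kmat n a) l \<longleftrightarrow> (\<exists>z. eigf n a l z)"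
proof
  assume "eigenvalue (kmat n a) l"
  then obtain v where v: "v \<in> carrier_vec n" "v \<noteq> 0\<^sub>v n" "kmat n a *\<^sub>v v = l \<cdot>\<^sub>v v"
    by (auto simp: eigenvalue_def eigenvector_def kmat_def)
  have vv: "vec n (\<lambda>i. v $ i) = v" using v by auto
  have "mv n a (\<lambda>i. v $ i) i = l * v $ i" if "i < n" for i
    using kmat_mult_vec[of n a "\<lambda>i. v $ i"] v that unfolding vv
    by (metis carrier_vecD index_smult_vec(1) index_vec)
  moreover have "\<exists>i<n. v $ i \<noteq> 0" using v by (metis carrier_vecD eq_vecI index_zero_vec)
  ultimately show "\<exists>z. eigf n a l z" unfolding eigf_def by blast
next
  assume "\<exists>z. eigf n a l z"
  then obtain z where z: "eigf n a l z" ..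
  have "kmat n a *\<^sub>v vec n z = l \<cdot>\<^sub>v vec n z"
    using z by (auto simp: kmat_mult_vec eigf_def)
  moreover have "vec n z \<noteq> 0\<^sub>v n"
    using z unfolding eigf_def by (metis index_vec index_zero_vec(1))
  ultimately show "eigenvalue (kmat n a) l"
    by (auto simp: eigenvalue_def eigenvector_def kmat_def intro!: exI[of _ "vec n z"])
qed

lemma spectrum_kmat: "l \<in> spectrum (kmat n a) \<longleftrightarrow> (\<exists>z. eigf n a l z)"
  by (simp add: spectrum_def eigenvalue_kmat)

text \<open>Dividing the kernel by \<open>s\<close> brings its spectral radius below 1; the entries
  of all powers of such a matrix share one bound \<open>c\<close>, and scaling back costs the factor
  \<open>s ^ k\<close>.\<close>

lemma mv_pow_bound:
  assumes n: "0 < n" and s: "spectral_radius (kmat n a) < s" and s0: "0 < s" and i: "i < n"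
  shows "\<exists>C. \<forall>k. \<bar>(mv n a ^^ k) f i\<bar> \<le> C * s ^ k"
proof -
  define b where "b = (\<lambda>i j. a i j / s)"
  have mvb: "mv n b g i = mv n a g i /\<^sub>R s" for g :: "nat \<Rightarrow> 'b :: real_vector" and i
    by (simp add: mv_def b_def divide_inverse scaleR_sum_right mult.commute)
  have pow: "(mv n b ^^ k) g = (\<lambda>i. (mv n a ^^ k) g i / s ^ k)" for k and g :: "nat \<Rightarrow> real"
  proof (induction k)
    case (Suc k)
    have "mv n b (\<lambda>i. (mv n a ^^ k) g i / s ^ k) = (\<lambda>i. mv n a ((mv n a ^^ k) g) i / s ^ Suc k)"
      using mv_mult[of n a "1 / s ^ k" "(mv n a ^^ k) g"] by (auto simp: mvb field_simps)
    then show ?case using Suc by simp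
  qed simp
  have "spectral_radius (kmat n b) < 1"
  proof -
    obtain m where m: "m \<in> spectrum (kmat n b)" "spectral_radius (kmat n b) = norm m"
      using spectral_radius_mem_max(1)[OF kmat_carrier n, of b] by auto
    then obtain z where "eigf n b m z" by (auto simp: spectrum_kmat)
    then have "eigf n a (s * m) z" using s0 by (auto simp: eigf_def mvb scaleR_conv_of_real field_simps)
    then have "norm (of_real s * m) \<le> spectral_radius (kmat n a)"
      by (intro spectral_radius_mem_max(2)[OF kmat_carrier n] imageI) (auto simp: spectrum_kmat)
    then show ?thesis using m s s0 by (simp add: norm_mult) (smt (verit) mult_le_cancel_left1)
  qed
  from spectral_radius_jnf_norm_bound_less_1_upper_triangular[OF kmat_carrier this]
  obtain c where c: "norm_bound (kmat n b ^\<^sub>m k) c" for k by blast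
  have "\<bar>(mv n a ^^ k) f i\<bar> \<le> (\<Sum>j<n. c * \<bar>f j\<bar>) * s ^ k" for k
  proof -
    let ?B = "kmat n b ^\<^sub>m k"
    have dim: "dim_row ?B = n" "dim_col ?B = n"
      using pow_carrier_mat[OF kmat_carrier, of n b k] by blast+
    have "complex_of_real ((mv n b ^^ k) f i) = (?B *\<^sub>v vec n (\<lambda>i. of_real (f i))) $ i"
      using i by (simp add: kmat_pow_mult_vec mv_pow_of_real)
    also have "\<dots> = (\<Sum>j<n. ?B $$ (i,j) * of_real (f j))"
      using i dim by (simp add: scalar_prod_def atLeast0LessThan)
    finally have "\<bar>(mv n b ^^ k) f i\<bar> = norm (\<Sum>j<n. ?B $$ (i,j) * of_real (f j))"
      by (metis norm_of_real)
    also have "\<dots> \<le> (\<Sum>j<n. c * \<bar>f j\<bar>)"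
      using c[of k] i dim
      by (intro sum_norm_le) (auto simp: norm_mult norm_bound_def intro!: mult_right_mono)
    finally show ?thesis using s0 by (simp add: pow field_simps)
  qed
  then show ?thesis by blast
qed

section \<open>Collatz--Wielandt bounds\<close>

locale nonneg_kernel =
  fixes n :: nat and a :: "nat \<Rightarrow> nat \<Rightarrow> real"
  assumes n_pos: "0 < n" and nonneg: "i < n \<Longrightarrow> j < n \<Longrightarrow> 0 \<le> a i j"
begin

abbreviation "T \<equiv> mv n a"

definition rho :: real where "rho = spectral_radius (kmat n a)"

lemma obtain_peripheral:
  obtains l z where "eigf n a l z" "norm l = rho"
proof -
  obtain m where "m \<in> spectrum (kmat n a)" "rho = norm m"
    using spectral_radius_mem_max(1)[OF kmat_carrier n_pos, of a] by (auto simp: rho_def)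
  then show ?thesis using that by (auto simp: spectrum_kmat)
qed

lemma rho_nonneg: "0 \<le> rho"
  using obtain_peripheral by (metis norm_ge_zero)

lemma T_nonneg: "(\<And>j. j < n \<Longrightarrow> 0 \<le> f j) \<Longrightarrow> i < n \<Longrightarrow> 0 \<le> (T f i :: real)"
  by (auto simp: mv_def nonneg intro!: sum_nonneg)

lemma T_pow_nonneg: "(\<And>j. j < n \<Longrightarrow> 0 \<le> f j) \<Longrightarrow> i < n \<Longrightarrow> 0 \<le> ((T ^^ k) f i :: real)"
  by (induction k arbitrary: i) (auto intro: T_nonneg)

lemma T_pow_mono:
  assumes "\<And>j. j < n \<Longrightarrow> f j \<le> g j" "i < n"
  shows "(T ^^ k) f i \<le> ((T ^^ k) g i :: real)"
  using T_pow_nonneg[of "\<lambda>i. g i - f i" i k] assms by (simp add: mv_pow_diff)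

lemma norm_T_pow_le:
  fixes z :: "nat \<Rightarrow> complex"
  shows "i < n \<Longrightarrow> norm ((T ^^ k) z i) \<le> (T ^^ k) (\<lambda>i. norm (z i)) i"
proof (induction k arbitrary: i)
  case (Suc k)
  have "norm (T ((T ^^ k) z) i) \<le> T (\<lambda>i. norm ((T ^^ k) z i)) i"
    unfolding mv_def using Suc.prems by (intro sum_norm_le) (simp add: nonneg)
  also have "\<dots> \<le> T ((T ^^ k) (\<lambda>i. norm (z i))) i"
    using T_pow_mono[of _ _ i 1] Suc by simp
  finally show ?case by simp
qed simp

text \<open>A peripheral eigenvector is compared in modulus with \<open>x\<close>, and the
  inequality is read off at the index where the quotient is largest.\<close>

lemma rho_pow_le:
  assumes x: "\<And>i. i < n \<Longrightarrow> 0 < x i" and le: "\<And>i. i < n \<Longrightarrow> (T ^^ p) x i \<le> m * x i"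
  shows "rho ^ p \<le> m"
proof -
  obtain l z where z: "eigf n a l z" "norm l = rho" by (rule obtain_peripheral)
  \<comment> \<open>\<open>t * x\<close> is the least multiple of \<open>x\<close> that dominates
    the moduli of \<open>z\<close>; equality holds at the index attaining the maximum.\<close>
  define t where "t = Max ((\<lambda>i. norm (z i) / x i) ` {..<n})"
  have "t \<in> (\<lambda>i. norm (z i) / x i) ` {..<n}"
    unfolding t_def using n_pos by (intro Max_in) auto
  then obtain i where i: "i < n" "t = norm (z i) / x i" by auto
  have le_t: "norm (z j) \<le> t * x j" if "j < n" for j
  proof -
    have "norm (z j) / x j \<le> t" unfolding t_def using that by (intro Max_ge) auto
    then show ?thesis using x[OF that] by (simp add: field_simps)
  qed
  obtain j where j: "j < n" "z j \<noteq> 0" using z by (auto simp: eigf_def)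
  have "0 < t * x j" using le_t[OF j(1)] j(2) by (smt (verit) zero_less_norm_iff)
  then have t: "0 < t" using x[OF j(1)] by (simp add: zero_less_mult_iff)
  have "(T ^^ p) z i = l ^ p * z i"
    using z i by (intro mv_pow_eig) (auto simp: eigf_def)
  then have "rho ^ p * norm (z i) \<le> (T ^^ p) (\<lambda>i. norm (z i)) i"
    using norm_T_pow_le[OF i(1), of p z] z(2) by (simp add: norm_mult norm_power)
  also have "\<dots> \<le> (T ^^ p) (\<lambda>i. t * x i) i"
    using le_t i by (intro T_pow_mono) auto
  also have "\<dots> \<le> t * (m * x i)"
    using le[OF i(1)] t by (simp add: mv_pow_mult)
  finally have "rho ^ p * (t * x i) \<le> m * (t * x i)"
    using i x[OF i(1)] by (simp add: mult_ac)
  then show ?thesis using t x[OF i(1)] by simp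
qed

text \<open>Iteration makes \<open>(T ^^ (p * q)) x i\<close> at least \<open>m ^ q * x i\<close>.
  If \<open>rho ^ p < m\<close>, an \<open>s\<close> strictly between \<open>rho\<close> and
  \<open>root p m\<close> limits the same value to \<open>C * s ^ (p * q)\<close>, which fails for
  large \<open>q\<close> because \<open>s ^ p < m\<close>.\<close>

lemma le_rho_pow:
  assumes x: "\<And>i. i < n \<Longrightarrow> 0 \<le> x i" and i: "i < n" "0 < x i"
    and le: "\<And>i. i < n \<Longrightarrow> m * x i \<le> (T ^^ p) x i"
  shows "m \<le> rho ^ p"
proof (rule ccontr)
  assume "\<not> ?thesis"
  then have m: "rho ^ p < m" by simp
  \<comment> \<open>For \<open>p = 0\<close> the hypothesis at \<open>i\<close> alone gives
    \<open>m \<le> 1\<close>; the root taken below requires a positive exponent.\<close>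
  have "p \<noteq> 0"
  proof
    assume "p = 0"
    then show False using le[OF i(1)] i(2) m by simp
  qed
  then have p: "0 < p" by simp
  have m0: "0 < m" using m rho_nonneg by (meson le_less_trans zero_le_power)
  have "rho < root p m"
    using real_root_less_mono[OF p m] rho_nonneg p by (simp add: real_root_power_cancel)
  then obtain s where s: "rho < s" "s < root p m" using dense by blast
  have s0: "0 < s" using s rho_nonneg by simp
  have sp: "s ^ p < m"
    using power_strict_mono[OF s(2) _ p] s0 m0 p by simp
  have iter: "m ^ q * x j \<le> (T ^^ (p * q)) x j" if "j < n" for q j
    using that
  proof (induction q arbitrary: j)
    case (Suc q)
    have "m ^ Suc q * x j \<le> m ^ q * (T ^^ p) x j"
      using le[OF Suc.prems] m0 by simp
    also have "\<dots> = (T ^^ p) (\<lambda>i. m ^ q * x i) j" by (simp add: mv_pow_mult)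
    also have "\<dots> \<le> (T ^^ p) ((T ^^ (p * q)) x) j"
      using Suc by (intro T_pow_mono) auto
    finally show ?case by (simp add: funpow_add)
  qed simp
  obtain C where C: "\<bar>(T ^^ k) x i\<bar> \<le> C * s ^ k" for k
    using mv_pow_bound[OF n_pos _ s0 i(1), of a x] s(1) unfolding rho_def by blast
  have "(m / s ^ p) ^ q \<le> C / x i" for q
  proof -
    have "m ^ q * x i \<le> C * s ^ (p * q)" using iter[OF i(1), of q] C[of "p * q"] by linarith
    then show ?thesis using s0 i(2) by (simp add: field_simps power_mult)
  qed
  moreover have "1 < m / s ^ p" using sp s0 by simp
  ultimately show False using real_arch_pow[of "m / s ^ p" "C / x i"] by (meson not_less)
qed

end

section \<open>Perron--Frobenius theory\<close>

text \<open>The reflexive closure in \<open>connected\<close> admits the zero kernel of size 1;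
  \<open>row_pos\<close> excludes it and so makes \<open>rho\<close> positive.\<close>

locale irreducible_kernel = nonneg_kernel +
  assumes connected: "i < n \<Longrightarrow> j < n \<Longrightarrow> (i, j) \<in> {(i, j). i < n \<and> j < n \<and> 0 < a i j}\<^sup>*"
    and row_pos: "i < n \<Longrightarrow> \<exists>j<n. 0 < a i j"
begin

lemma path_induct [consumes 2, case_names base step]:
  assumes "i < n" "j < n" "P i"
    and "\<And>u v. u < n \<Longrightarrow> v < n \<Longrightarrow> 0 < a u v \<Longrightarrow> P u \<Longrightarrow> P v"
  shows "P j"
  using connected[OF assms(1,2)] assms(3)
  by (induction rule: rtrancl_induct) (auto intro: assms(4))

lemma path_induct_rev [consumes 2, case_names base step]:
  assumes "i < n" "j < n" "P j"
    and "\<And>u v. u < n \<Longrightarrow> v < n \<Longrightarrow> 0 < a u v \<Longrightarrow> P v \<Longrightarrow> P u"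
  shows "P i"
  using connected[OF assms(1,2)] assms(3)
  by (induction rule: converse_rtrancl_induct) (auto intro: assms(4))

text \<open>Positivity at \<open>j\<close> moves backwards along a path from \<open>i\<close> to
  \<open>j\<close>, one application of \<open>T\<close> per arc.\<close>

lemma exists_T_pow_pos:
  fixes f :: "nat \<Rightarrow> real"
  assumes f: "\<And>i. i < n \<Longrightarrow> 0 \<le> f i" and j: "j < n" "0 < f j" and i: "i < n"
  shows "\<exists>t. 0 < (T ^^ t) f i"
  using i j(1)
proof (induction rule: path_induct_rev)
  case base
  show ?case using j(2) by (intro exI[of _ 0]) simp
next
  case (step u v)
  then obtain t where t: "0 < (T ^^ t) f v" by blast
  define g where "g = (T ^^ t) f"
  have "0 \<le> g i" if "i < n" for i
    unfolding g_def using f that by (rule T_pow_nonneg)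
  then have "0 < T g u"
    unfolding mv_def using step t nonneg by (intro sum_pos2[of _ v]) (auto simp flip: g_def)
  then show ?case by (intro exI[of _ "Suc t"]) (simp add: g_def)
qed

text \<open>Plays the role of \<open>(I + A)\<^sup>n f > 0\<close> for irreducible \<open>A\<close>.\<close>

lemma exists_sum_T_pow_pos:
  fixes f :: "nat \<Rightarrow> real"
  assumes f: "\<And>i. i < n \<Longrightarrow> 0 \<le> f i" and j: "j < n" "0 < f j"
  shows "\<exists>K. \<forall>i<n. 0 < (\<Sum>t\<le>K. (T ^^ t) f i)"
proof -
  obtain t where t: "\<And>i. i < n \<Longrightarrow> 0 < (T ^^ t i) f i"
    using exists_T_pow_pos[where f = f, OF f j] by metis
  have "0 < (\<Sum>s\<le>Max (t ` {..<n}). (T ^^ s) f i)" if "i < n" for i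
  proof (rule sum_pos2[where i = "t i"])
    show "0 \<le> (T ^^ s) f i" for s using f that by (rule T_pow_nonneg)
  qed (use t that in auto)
  then show ?thesis by blast
qed

text \<open>Powers of \<open>T\<close> commute, so smoothing \<open>x\<close> by a sum of its
  iterates smooths its defect in the same way.\<close>

lemma T_pow_sum_commute:
  fixes c :: real
  shows "(T ^^ p) (\<lambda>i. \<Sum>t\<in>S. (T ^^ t) x i) i - c * (\<Sum>t\<in>S. (T ^^ t) x i) =
    (\<Sum>t\<in>S. (T ^^ t) (\<lambda>i. (T ^^ p) x i - c * x i) i)"
proof -
  have "(T ^^ p) ((T ^^ t) x) = (T ^^ t) ((T ^^ p) x)" for t
    by (metis add.commute funpow_add o_apply)
  then show ?thesis
    by (simp add: mv_pow_sum mv_pow_diff mv_pow_mult sum_subtractf sum_distrib_left)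
qed

text \<open>A strict inequality at one index becomes strict everywhere after summing enough
  iterates. The sum \<open>X\<close> then satisfies the hypothesis of \<open>rho_pow_le\<close> with
  \<open>rho ^ p\<close> lowered by some \<open>e > 0\<close>.\<close>

lemma supersolution_eq:
  assumes x: "\<And>i. i < n \<Longrightarrow> 0 < x i" and le: "\<And>i. i < n \<Longrightarrow> (T ^^ p) x i \<le> rho ^ p * x i"
    and i: "i < n"
  shows "(T ^^ p) x i = rho ^ p * x i"
proof (rule ccontr)
  define f where "f = (\<lambda>i. rho ^ p * x i - (T ^^ p) x i)"
  assume "\<not> ?thesis"
  then have "0 < f i" "\<And>i. i < n \<Longrightarrow> 0 \<le> f i" using le i by (force simp: f_def)+
  then obtain K where K: "\<And>i. i < n \<Longrightarrow> 0 < (\<Sum>t\<le>K. (T ^^ t) f i)"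
    using exists_sum_T_pow_pos i by blast
  define X where "X = (\<lambda>i. \<Sum>t\<le>K. (T ^^ t) x i)"
  have X: "0 < X i" if "i < n" for i
    unfolding X_def using x that by (intro sum_pos2[of _ 0]) (auto intro!: T_pow_nonneg simp: less_imp_le)
  have TX: "(T ^^ p) X i = rho ^ p * X i - (\<Sum>t\<le>K. (T ^^ t) f i)" for i
    using T_pow_sum_commute[where p = p and S = "{..K}" and x = x and i = i and c = "rho ^ p"]
    by (simp add: X_def f_def mv_pow_diff sum_subtractf)
  define e where "e = Min ((\<lambda>i. (\<Sum>t\<le>K. (T ^^ t) f i) / X i) ` {..<n})"
  have "0 < e" unfolding e_def using X K n_pos by (subst Min_gr_iff) auto
  moreover have "rho ^ p \<le> rho ^ p - e"
  proof (rule rho_pow_le[OF X])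
    fix i assume i: "i < n"
    have "e \<le> (\<Sum>t\<le>K. (T ^^ t) f i) / X i" unfolding e_def using i by (intro Min_le) auto
    then show "(T ^^ p) X i \<le> (rho ^ p - e) * X i"
      using X[OF i] by (simp add: TX field_simps)
  qed
  ultimately show False by simp
qed

text \<open>Dual argument through \<open>le_rho_pow\<close>. Zeros of \<open>x\<close> are allowed
  because the lemma is applied to the moduli of an eigenvector before these are known to be
  positive.\<close>

lemma subsolution_eq:
  assumes x: "\<And>i. i < n \<Longrightarrow> 0 \<le> x i" and j: "j < n" "0 < x j"
    and le: "\<And>i. i < n \<Longrightarrow> rho ^ p * x i \<le> (T ^^ p) x i" and i: "i < n"
  shows "(T ^^ p) x i = rho ^ p * x i"
proof (rule ccontr)
  define f where "f = (\<lambda>i. (T ^^ p) x i - rho ^ p * x i)"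
  assume "\<not> ?thesis"
  then have "0 < f i" "\<And>i. i < n \<Longrightarrow> 0 \<le> f i" using le i by (force simp: f_def)+
  then obtain K where K: "\<And>i. i < n \<Longrightarrow> 0 < (\<Sum>t\<le>K. (T ^^ t) f i)"
    using exists_sum_T_pow_pos i by blast
  define X where "X = (\<lambda>i. \<Sum>t\<le>K. (T ^^ t) x i)"
  have X: "0 \<le> X i" if "i < n" for i
    unfolding X_def using x that by (intro sum_nonneg T_pow_nonneg) auto
  have Xj: "0 < X j"
    unfolding X_def using x j by (intro sum_pos2[of _ 0]) (auto intro!: T_pow_nonneg)
  have TX: "(T ^^ p) X i = rho ^ p * X i + (\<Sum>t\<le>K. (T ^^ t) f i)" for i
    using T_pow_sum_commute[where p = p and S = "{..K}" and x = x and i = i and c = "rho ^ p"]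
    by (simp add: X_def f_def algebra_simps)
  \<comment> \<open>\<open>X\<close> is only known to be nonnegative, so the gap is measured against
    \<open>X i + 1\<close>, which exceeds \<open>X i\<close> and is safe to divide by.\<close>
  define e where "e = Min ((\<lambda>i. (\<Sum>t\<le>K. (T ^^ t) f i) / (X i + 1)) ` {..<n})"
  have X1: "0 < X i + 1" if "i < n" for i using X[OF that] by simp
  have e: "0 < e" unfolding e_def using X1 K n_pos by (subst Min_gr_iff) auto
  have "rho ^ p + e \<le> rho ^ p"
  proof (rule le_rho_pow[where x = X, OF X j(1) Xj])
    fix i assume i: "i < n"
    have "e \<le> (\<Sum>t\<le>K. (T ^^ t) f i) / (X i + 1)" unfolding e_def using i by (intro Min_le) auto
    then have "e * (X i + 1) \<le> (\<Sum>t\<le>K. (T ^^ t) f i)"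
      using X1[OF i] by (simp add: field_simps)
    then show "(rho ^ p + e) * X i \<le> (T ^^ p) X i"
      using e by (simp add: TX algebra_simps)
  qed
  with e show False by simp
qed

text \<open>By the triangle inequality the moduli of \<open>z\<close> form a subsolution, hence an
  eigenvector for \<open>rho\<close>; irreducibility makes some iterate positive at
  \<open>i\<close>, and that iterate is a multiple of \<open>norm (z i)\<close>.\<close>

lemma peripheral_norm:
  assumes z: "eigf n a l z" "norm l = rho" and i: "i < n"
  shows "T (\<lambda>i. norm (z i)) i = rho * norm (z i)" and "z i \<noteq> 0"
proof -
  obtain j where j: "j < n" "0 < norm (z j)" using z by (auto simp: eigf_def)
  have "rho ^ 1 * norm (z i) \<le> (T ^^ 1) (\<lambda>i. norm (z i)) i" if "i < n" for i
    using norm_T_pow_le[OF that, of 1 z] z that by (simp add: eigf_def norm_mult)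
  then have T: "T (\<lambda>i. norm (z i)) i = rho * norm (z i)" if "i < n" for i
    using subsolution_eq[of "\<lambda>i. norm (z i)" j 1 i] j that by simp
  from T[OF i] show "T (\<lambda>i. norm (z i)) i = rho * norm (z i)" .
  obtain t where "0 < (T ^^ t) (\<lambda>i. norm (z i)) i"
    using exists_T_pow_pos[of "\<lambda>i. norm (z i)"] j i by auto
  then show "z i \<noteq> 0"
    using mv_pow_eig[of n a "\<lambda>i. norm (z i)" rho i t] T i by auto
qed

text \<open>A Perron vector with its scale left open; the moduli of any peripheral eigenvector
  provide one.\<close>

definition pf :: "nat \<Rightarrow> real" where
  "pf = (SOME p. \<forall>i<n. T p i = rho * p i \<and> 0 < p i)"

lemma pf: "i < n \<Longrightarrow> T pf i = rho * pf i" "i < n \<Longrightarrow> 0 < pf i"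
proof -
  obtain l z where "eigf n a l z" "norm l = rho" by (rule obtain_peripheral)
  then have "\<exists>p. \<forall>i<n. T p i = rho * p i \<and> 0 < p i"
    using peripheral_norm by (intro exI[of _ "\<lambda>i. norm (z i)"]) auto
  then have "\<forall>i<n. T pf i = rho * pf i \<and> 0 < pf i" unfolding pf_def by (rule someI_ex)
  then show "i < n \<Longrightarrow> T pf i = rho * pf i" "i < n \<Longrightarrow> 0 < pf i" by auto
qed

lemma rho_pos: "0 < rho"
proof -
  obtain j where j: "j < n" "0 < a 0 j" using row_pos n_pos by blast
  have "0 < T pf 0"
    unfolding mv_def using j pf n_pos by (intro sum_pos2[of _ j]) (auto simp: nonneg less_imp_le)
  then show ?thesis using pf(1)[of 0] pf(2)[of 0] n_pos by (simp add: zero_less_mult_iff)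
qed

text \<open>Subtracting the multiple of \<open>w\<close> that cancels entry 0 leaves either zero or
  an eigenvector with a zero entry, which \<open>peripheral_norm\<close> forbids.\<close>

lemma peripheral_proportional:
  assumes z: "eigf n a l z" and w: "eigf n a l w" and l: "norm l = rho"
  shows "\<exists>c. \<forall>i<n. z i = c * w i"
proof (rule ccontr)
  define c where "c = z 0 / w 0"
  have w0: "w 0 \<noteq> 0" using peripheral_norm(2)[OF w l n_pos] .
  assume "\<not> ?thesis"
  then obtain i where "i < n" "z i \<noteq> c * w i" by blast
  then have "eigf n a l (\<lambda>i. z i - c * w i)"
    using z w by (auto simp: eigf_def mv_diff mv_mult algebra_simps)
  from peripheral_norm(2)[OF this l n_pos] show False using w0 by (simp add: c_def)
qed

text \<open>The triangle inequality \<open>rho * norm (z i) = norm (T z i) \<le> T (norm \<circ> z) i\<close> is an equality,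
  so all summands of \<open>T z i\<close> point in the same direction.\<close>

lemma peripheral_sgn:
  assumes z: "eigf n a l z" and l: "norm l = rho" and ij: "i < n" "j < n" "0 < a i j"
  shows "sgn (z j) = l / rho * sgn (z i)"
proof -
  define b where "b = l / rho * sgn (z i)"
  \<comment> \<open>Multiplication by \<open>cnj b\<close> rotates the direction of
    \<open>T z i\<close> onto the positive real axis. Comparing real parts then gives a vanishing
    sum of nonnegative defects.\<close>
  define c where "c = (\<lambda>k. cnj b * z k)"
  have nz: "z k \<noteq> 0" if "k < n" for k using peripheral_norm(2)[OF z l that] .
  have b: "norm b = 1" using rho_pos l nz[OF ij(1)] by (simp add: b_def norm_mult norm_divide norm_sgn)
  then have bb: "cnj b * b = 1" by (simp add: complex_norm_square mult.commute flip: complex_norm_square)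
  have "of_real rho * norm (z i) * b = l * z i"
    using rho_pos nz[OF ij(1)] by (simp add: b_def sgn_eq)
  then have "T z i = of_real (rho * norm (z i)) * b" using z ij by (simp add: eigf_def)
  then have "T c i = of_real (rho * norm (z i))"
    using bb by (simp add: c_def mv_mult)
  then have "Re (T c i) = T (\<lambda>i. norm (z i)) i"
    using peripheral_norm(1)[OF z l ij(1)] by simp
  then have "(\<Sum>k<n. a i k * (norm (z k) - Re (c k))) = 0"
    by (simp add: mv_def algebra_simps sum_subtractf)
  moreover have Re_le: "Re (c k) \<le> norm (z k)" for k
    using complex_Re_le_cmod[of "c k"] b by (simp add: c_def norm_mult)
  ultimately have "a i j * (norm (z j) - Re (c j)) = 0"
    using ij nonneg by (subst (asm) sum_nonneg_eq_0_iff) (auto dest: bspec[of _ _ j])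
  then have Re: "Re (c j) = norm (c j)" using ij b by (simp add: c_def norm_mult)
  then have "Im (c j) = 0" using cmod_power2[of "c j"] by simp
  with Re have "c j = of_real (norm (c j))" by (simp add: complex_eq_iff)
  then have "cnj b * z j = of_real (norm (z j))" using b by (simp add: c_def norm_mult)
  then have "z j = b * of_real (norm (z j))" using bb by (metis mult.assoc mult.commute mult_1)
  then have "sgn (z j) = b" using nz[OF ij(2)] by (simp add: sgn_eq field_simps)
  then show ?thesis by (simp add: b_def)
qed

end

section \<open>Peripheral eigenvalues\<close>

lemma power_gcd_eq_1:
  fixes z :: complex
  assumes "z ^ m = 1" "z ^ k = 1" "0 < m"
  shows "z ^ gcd m k = 1"
proof -
  obtain x y where xy: "m * x = k * y + gcd m k" using bezout_nat[of m k] assms(3) by auto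
  have "z ^ (m * x) = 1" using assms by (simp add: power_mult)
  moreover have "z ^ (m * x) = z ^ gcd m k" using assms by (simp add: xy power_add power_mult)
  ultimately show ?thesis by simp
qed

text \<open>Lagrange's argument: multiplication by \<open>u\<close> permutes \<open>S\<close>, so
  the nonzero product over \<open>S\<close> is unchanged by the factor
  \<open>u ^ card S\<close>.\<close>

lemma finite_mult_closed_power_card:
  fixes S :: "complex set"
  assumes S: "finite S" "0 \<notin> S" and closed: "\<And>u v. u \<in> S \<Longrightarrow> v \<in> S \<Longrightarrow> u * v \<in> S" and u: "u \<in> S"
  shows "u ^ card S = 1"
proof -
  have u0: "u \<noteq> 0" using S u by auto
  have inj: "inj_on ((*) u) S" using u0 by (auto simp: inj_on_def)
  have "(*) u ` S = S" using S closed[OF u] inj by (intro card_subset_eq) (auto simp: card_image)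
  then have "\<Prod>S = (\<Prod>v\<in>S. u * v)" using prod.reindex[OF inj, of "\<lambda>v. v"] by simp
  also have "\<dots> = u ^ card S * \<Prod>S" by (simp add: prod.distrib)
  finally show ?thesis using S by simp
qed

text \<open>In a Schur decomposition with \<open>l\<close> in the first two diagonal places, the
  first two columns of \<open>P\<close> serve as \<open>p\<close> and \<open>q\<close> and the entry
  \<open>B $$ (0, 1)\<close> as \<open>c\<close>. Invertibility of \<open>P\<close> gives their
  independence.\<close>

lemma double_root_vectors:
  assumes dvd: "[:- l, 1:] ^ 2 dvd char_poly (kmat n a)" and n: "0 < n"
  shows "\<exists>p q c. (\<forall>i<n. mv n a p i = l * p i) \<and> (\<forall>i<n. mv n a q i = l * q i + c * p i) \<and>
    (\<exists>i<n. p i \<noteq> 0) \<and> (\<forall>e. \<exists>i<n. q i \<noteq> e * p i)"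
proof -
  let ?A = "kmat n a"
  have deg: "degree (char_poly ?A) = n" "lead_coeff (char_poly ?A) = 1"
    using degree_monic_char_poly[OF kmat_carrier, of n a] by auto
  obtain g where g: "char_poly ?A = [:- l, 1:] ^ 2 * g" using dvd by (elim dvdE)
  have g0: "g \<noteq> 0" using g deg n by auto
  have "lead_coeff g = 1" using deg(2) by (simp add: g lead_coeff_mult lead_coeff_power)
  then obtain as where as: "g = (\<Prod>b\<leftarrow>as. [:- b, 1:])"
    using fundamental_theorem_algebra_factorized[of g] by auto
  have "n = 2 + degree g" using deg(1) g0 by (simp add: g degree_mult_eq degree_power_eq)
  then have n2: "1 < n" by simp
  \<comment> \<open>The Schur decomposition puts the eigenvalues on the diagonal in the order of
    this list, hence \<open>l\<close> twice in front.\<close>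
  have fact: "char_poly ?A = (\<Prod>b\<leftarrow>l # l # as. [:- b, 1:])"
    by (simp only: g as power2_eq_square list.map prod_list.Cons mult.assoc)
  obtain B P Q where schur: "schur_decomposition ?A (l # l # as) = (B, P, Q)" by (metis prod_cases3)
  from schur_decomposition[OF kmat_carrier fact schur]
  have sim: "similar_mat_wit ?A B P Q" and ut: "upper_triangular B" and diag: "diag_mat B = l # l # as"
    by auto
  note D = similar_mat_witD2[OF kmat_carrier sim]
  have dims: "dim_row B = n" "dim_col B = n" "dim_row P = n" "dim_col P = n" "dim_row Q = n" "dim_col Q = n"
    using D by auto
  have "diag_mat B ! 0 = B $$ (0, 0)" "diag_mat B ! 1 = B $$ (1, 1)"
    using n2 dims by (simp_all add: diag_mat_def)
  then have B: "B $$ (0, 0) = l" "B $$ (1, 1) = l" by (simp_all add: diag)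
  have "?A * P = P * B * (Q * P)"
    using D by (simp add: assoc_mult_mat[of _ n n _ n _ n])
  then have AP: "?A * P = P * B" using D by simp
  have col: "mv n a (\<lambda>i. P $$ (i, j)) i = (\<Sum>k\<in>{..j}. P $$ (i, k) * B $$ (k, j))"
    if "i < n" "j < n" for i j
  proof -
    have "mv n a (\<lambda>i. P $$ (i, j)) i = (?A * P) $$ (i, j)"
      using that dims by (simp add: mv_def kmat_def scalar_prod_def scaleR_conv_of_real atLeast0LessThan)
    also have "\<dots> = (\<Sum>k<n. P $$ (i, k) * B $$ (k, j))"
      using that dims by (simp add: AP scalar_prod_def atLeast0LessThan)
    also have "\<dots> = (\<Sum>k\<in>{..j}. P $$ (i, k) * B $$ (k, j))"
      using that dims ut by (intro sum.mono_neutral_right) (auto intro!: upper_triangularD[OF ut])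
    finally show ?thesis .
  qed
  have QP: "(\<Sum>k<n. Q $$ (i, k) * P $$ (k, j)) = (if i = j then 1 else 0)" if "i < n" "j < n" for i j
  proof -
    have "(Q * P) $$ (i, j) = (if i = j then 1 else 0)" using D(2) that by simp
    then show ?thesis using that dims by (simp add: scalar_prod_def atLeast0LessThan)
  qed
  show ?thesis
  proof (rule exI[of _ "\<lambda>i. P $$ (i, 0)"], rule exI[of _ "\<lambda>i. P $$ (i, 1)"],
      rule exI[of _ "B $$ (0, 1)"], intro conjI allI impI)
    show "mv n a (\<lambda>i. P $$ (i, 0)) i = l * P $$ (i, 0)" if "i < n" for i
      using col[OF that, of 0] n by (simp add: B mult.commute)
    show "mv n a (\<lambda>i. P $$ (i, 1)) i = l * P $$ (i, 1) + B $$ (0, 1) * P $$ (i, 0)" if "i < n" for i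
      using col[OF that n2] B by (simp add: mult.commute)
    show "\<exists>i<n. P $$ (i, 0) \<noteq> 0"
    proof (rule ccontr)
      assume "\<not> ?thesis"
      then show False using QP[OF n n] by simp
    qed
    show "\<exists>i<n. P $$ (i, 1) \<noteq> e * P $$ (i, 0)" for e
    proof (rule ccontr)
      assume "\<not> ?thesis"
      \<comment> \<open>Row 1 of \<open>Q\<close> sends column 1 of \<open>P\<close> to 1 and column
        0 to 0.\<close>
      then have "(\<Sum>k<n. Q $$ (1, k) * P $$ (k, 1)) = e * (\<Sum>k<n. Q $$ (1, k) * P $$ (k, 0))"
        by (simp add: sum_distrib_left mult_ac)
      then show False using QP[OF n2 n2] QP[OF n2 n] by simp
    qed
  qed
qed

section \<open>The group of normalized peripheral eigenvalues and their simplicity\<close>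

context irreducible_kernel
begin

definition periph :: "complex set" where
  "periph = {u. norm u = 1 \<and> (\<exists>z. eigf n a (rho * u) z)}"

text \<open>The normalization \<open>d 0 = 1\<close> removes a free unimodular factor, survives
  products, and starts inductions along paths from index 0.\<close>

definition phase :: "complex \<Rightarrow> (nat \<Rightarrow> complex) \<Rightarrow> bool" where
  "phase u d \<longleftrightarrow> (\<forall>i<n. norm (d i) = 1) \<and> d 0 = 1 \<and>
     (\<forall>i<n. \<forall>j<n. 0 < a i j \<longrightarrow> d j = u * d i)"

lemma phase_mult: "phase u d \<Longrightarrow> phase v e \<Longrightarrow> phase (u * v) (\<lambda>i. d i * e i)"
  by (auto simp: phase_def norm_mult)

lemma phase_power: "phase u d \<Longrightarrow> phase (u ^ k) (\<lambda>i. d i ^ k)"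
  by (auto simp: phase_def norm_power power_mult_distrib)

text \<open>With \<open>D\<close> the diagonal matrix of \<open>d\<close>, the arc condition says
  \<open>A D = u D A\<close>; applying this to the Perron vector gives the claim.\<close>

lemma phase_eigf:
  fixes u :: complex
  assumes "phase u d"
  shows "eigf n a (rho * u) (\<lambda>i. d i * of_real (pf i))"
proof -
  have d: "d j = u * d i" if "i < n" "j < n" "0 < a i j" for i j
    using assms that by (auto simp: phase_def)
  have "T (\<lambda>i. d i * of_real (pf i)) i = rho * u * (d i * of_real (pf i))" if i: "i < n" for i
  proof -
    have "T (\<lambda>i. d i * of_real (pf i)) i = (\<Sum>j<n. a i j *\<^sub>R (u * d i * of_real (pf j)))"
      unfolding mv_def
    proof (intro sum.cong refl)
      fix j assume "j \<in> {..<n}"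
      then show "a i j *\<^sub>R (d j * of_real (pf j)) = a i j *\<^sub>R (u * d i * of_real (pf j))"
        using d[OF i, of j] nonneg[OF i, of j] by (cases "0 < a i j") auto
    qed
    also have "\<dots> = u * d i * of_real (T pf i)"
      by (simp add: mv_def sum_distrib_left scaleR_conv_of_real mult_ac)
    finally show ?thesis using pf(1)[OF i] by simp
  qed
  moreover have "d 0 * of_real (pf 0) \<noteq> 0" using assms pf(2)[OF n_pos] by (simp add: phase_def)
  ultimately show ?thesis unfolding eigf_def by (intro conjI exI[of _ 0] allI impI n_pos)
qed

text \<open>The signs of the entries of a peripheral eigenvector, taken relative to entry 0, obey
  the arc condition by \<open>peripheral_sgn\<close>.\<close>

lemma periph_phase:
  fixes u :: complex
  assumes "u \<in> periph"
  shows "\<exists>d. phase u d"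
proof -
  from assms obtain z where u: "norm u = 1" and z: "eigf n a (rho * u) z" by (auto simp: periph_def)
  have l: "norm (rho * u) = rho" using u rho_pos by (simp add: norm_mult)
  have nz: "z i \<noteq> 0" if "i < n" for i using peripheral_norm(2)[OF z l that] .
  have "phase u (\<lambda>i. sgn (z i) / sgn (z 0))"
    unfolding phase_def
  proof (intro conjI allI impI)
    show "norm (sgn (z i) / sgn (z 0)) = 1" if "i < n" for i
      using nz[OF that] nz[OF n_pos] by (simp add: norm_divide norm_sgn)
    show "sgn (z j) / sgn (z 0) = u * (sgn (z i) / sgn (z 0))" if "i < n" "j < n" "0 < a i j" for i j
      using peripheral_sgn[OF z l that] rho_pos by simp
    show "sgn (z 0) / sgn (z 0) = 1" using nz[OF n_pos] by (simp add: sgn_zero_iff)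
  qed
  then show ?thesis by (intro exI)
qed

lemma finite_periph: "finite periph"
proof (rule finite_subset)
  show "periph \<subseteq> (\<lambda>l. l / rho) ` spectrum (kmat n a)"
  proof
    fix u assume "u \<in> periph"
    then have "rho * u \<in> spectrum (kmat n a)" by (auto simp: periph_def spectrum_kmat)
    then show "u \<in> (\<lambda>l. l / rho) ` spectrum (kmat n a)"
      using rho_pos by (intro image_eqI[of _ _ "rho * u"]) auto
  qed
qed (simp add: card_finite_spectrum(1)[OF kmat_carrier])

lemma periph_iff_phase: "u \<in> periph \<longleftrightarrow> norm u = 1 \<and> (\<exists>d. phase u d)"
  using periph_phase phase_eigf unfolding periph_def by blast

lemma one_periph: "1 \<in> periph"
  unfolding periph_iff_phase phase_def by (auto intro!: exI[of _ "\<lambda>_. 1"])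

lemma periph_mult: "u \<in> periph \<Longrightarrow> v \<in> periph \<Longrightarrow> u * v \<in> periph"
  unfolding periph_iff_phase by (auto simp: norm_mult intro: phase_mult)

lemma card_periph_pos: "0 < card periph"
  using finite_periph one_periph by (auto simp: card_gt_0_iff)

text \<open>Lagrange's argument gives one inclusion; both sets have \<open>card periph\<close>
  elements.\<close>

lemma periph_eq_roots_unity: "periph = {u. u ^ card periph = 1}"
proof (rule card_subset_eq)
  show "finite {u::complex. u ^ card periph = 1}"
    using card_periph_pos by (intro finite_roots_unity) auto
  show "periph \<subseteq> {u. u ^ card periph = 1}"
    using finite_mult_closed_power_card[OF finite_periph _ periph_mult] by (auto simp: periph_def)
  show "card periph = card {u::complex. u ^ card periph = 1}"
    using card_roots_unity_eq[OF card_periph_pos] by simp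
qed

text \<open>Along a Jordan chain the iterates of \<open>v\<close> would grow like
  \<open>k * rho ^ k\<close>, whereas domination of \<open>v\<close> by a multiple of the Perron
  vector allows only growth like \<open>rho ^ k\<close>.\<close>

lemma no_generalized_peripheral:
  assumes z: "eigf n a l z" and l: "norm l = rho" and v: "\<And>i. i < n \<Longrightarrow> T v i = l * v i + z i"
  shows False
proof -
  \<comment> \<open>The extra factor \<open>l\<close> on the left avoids the exponent
    \<open>k - 1\<close> of the usual formula.\<close>
  have pow: "l * (T ^^ k) v i = l ^ Suc k * v i + of_nat k * l ^ k * z i" if "i < n" for i k
    using that
  proof (induction k arbitrary: i)
    case (Suc k)
    have "l * (T ^^ Suc k) v i = T (\<lambda>i. l * (T ^^ k) v i) i" by (simp add: mv_mult)
    also have "\<dots> = T (\<lambda>i. l ^ Suc k * v i + of_nat k * l ^ k * z i) i"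
      using Suc.IH by (intro mv_cong) auto
    also have "\<dots> = l ^ Suc k * T v i + of_nat k * l ^ k * T z i"
      by (simp only: mv_add mv_mult)
    also have "\<dots> = l ^ Suc (Suc k) * v i + of_nat (Suc k) * l ^ Suc k * z i"
      using v[OF Suc.prems] z Suc.prems by (simp add: eigf_def algebra_simps)
    finally show ?case .
  qed simp
  define t where "t = Max ((\<lambda>i. norm (v i) / pf i) ` {..<n})"
  have t: "norm (v j) \<le> t * pf j" if "j < n" for j
  proof -
    have "norm (v j) / pf j \<le> t" unfolding t_def using that by (intro Max_ge) auto
    then show ?thesis using pf(2)[OF that] by (simp add: field_simps)
  qed
  have "real k * norm (z 0) \<le> rho * (t * pf 0) + rho * norm (v 0)" for k
  proof -
    have "norm ((T ^^ k) v 0) \<le> (T ^^ k) (\<lambda>i. t * pf i) 0"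
      using norm_T_pow_le[OF n_pos, of k v] T_pow_mono[where f = "\<lambda>i. norm (v i)", OF t n_pos, of k] by simp
    also have "\<dots> = t * (rho ^ k * pf 0)"
      using mv_pow_eig[of n a pf rho 0 k] pf n_pos by (simp add: mv_pow_mult)
    finally have b: "norm ((T ^^ k) v 0) \<le> t * (rho ^ k * pf 0)" .
    have "of_nat k * l ^ k * z 0 = l * (T ^^ k) v 0 - l ^ Suc k * v 0"
      using pow[OF n_pos] by simp
    then have "norm (of_nat k * l ^ k * z 0) \<le> norm (l * (T ^^ k) v 0) + norm (l ^ Suc k * v 0)"
      by (metis norm_triangle_ineq4)
    then have "rho ^ k * (k * norm (z 0)) \<le> rho * norm ((T ^^ k) v 0) + rho ^ Suc k * norm (v 0)"
      using l by (simp add: norm_mult norm_power mult_ac)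
    also have "\<dots> \<le> rho * (t * (rho ^ k * pf 0)) + rho ^ Suc k * norm (v 0)"
      using b rho_pos by simp
    also have "\<dots> = rho ^ k * (rho * (t * pf 0) + rho * norm (v 0))" by (simp add: algebra_simps)
    finally show ?thesis using rho_pos by simp
  qed
  moreover have "0 < norm (z 0)" using peripheral_norm(2)[OF z l n_pos] by simp
  ultimately show False using reals_Archimedean3 by (meson not_less)
qed

text \<open>A double root yields either two independent eigenvectors (\<open>c = 0\<close>), against
  \<open>peripheral_proportional\<close>, or a Jordan chain, against
  \<open>no_generalized_peripheral\<close>.\<close>

lemma order_peripheral:
  assumes z: "eigf n a l z" and l: "norm l = rho"
  shows "Polynomial.order l (char_poly (kmat n a)) = 1"
proof -
  let ?c = "char_poly (kmat n a)"
  have c0: "?c \<noteq> 0" using degree_monic_char_poly[OF kmat_carrier, of n a] n_pos by auto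
  have "poly ?c l = 0"
    using eigenvalue_root_char_poly[OF kmat_carrier, of n a l] eigenvalue_kmat z by blast
  then have "Polynomial.order l ?c \<noteq> 0" using c0 by (simp add: order_root)
  moreover have "\<not> 2 \<le> Polynomial.order l ?c"
  proof
    assume "2 \<le> Polynomial.order l ?c"
    then have "[:- l, 1:] ^ 2 dvd ?c" by (simp add: order_divides)
    from double_root_vectors[OF this n_pos]
    obtain p q c where "(\<forall>i<n. T p i = l * p i) \<and> (\<forall>i<n. T q i = l * q i + c * p i) \<and>
      (\<exists>i<n. p i \<noteq> 0) \<and> (\<forall>e. \<exists>i<n. q i \<noteq> e * p i)"
      by (elim exE)
    then have p: "\<forall>i<n. T p i = l * p i" and q: "\<forall>i<n. T q i = l * q i + c * p i"
      and p0: "\<exists>i<n. p i \<noteq> 0" and ind: "\<forall>e. \<exists>i<n. q i \<noteq> e * p i"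
      by auto
    show False
    proof (cases "c = 0")
      case True
      have "eigf n a l p" using p p0 by (auto simp: eigf_def)
      \<comment> \<open>Independence with \<open>e = 0\<close> says that \<open>q\<close> is
        nonzero.\<close>
      moreover have "eigf n a l q" using q ind[rule_format, of 0] True by (auto simp: eigf_def)
      ultimately show False using peripheral_proportional[of l q p] l ind by blast
    next
      case False
      then have "eigf n a l (\<lambda>i. c * p i)" using p p0 by (auto simp: eigf_def mv_mult)
      from no_generalized_peripheral[OF this l, of q] q show False by blast
    qed
  qed
  ultimately show ?thesis by linarith
qed

text \<open>Identifies the imprimitivity index with \<open>card periph\<close>: scaling by
  \<open>rho\<close> is a bijection onto the peripheral spectrum, and each order is 1.\<close>

lemma sum_order_peripheral:
  "(\<Sum>z \<in> {z \<in> spectrum (kmat n a). cmod z = rho}. Polynomial.order z (char_poly (kmat n a))) = card periph"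
proof -
  let ?S = "{z \<in> spectrum (kmat n a). cmod z = rho}"
  have "?S = (\<lambda>u. rho * u) ` periph"
  proof (intro equalityI subsetI)
    fix l assume "l \<in> ?S"
    then show "l \<in> (\<lambda>u. rho * u) ` periph"
      using rho_pos
      by (intro image_eqI[of _ _ "l / rho"]) (auto simp: periph_def spectrum_kmat norm_divide)
  qed (use rho_pos in \<open>auto simp: periph_def spectrum_kmat norm_mult\<close>)
  then have "card ?S = card periph"
    using rho_pos by (auto intro: card_image simp: inj_on_def)
  moreover have "(\<Sum>z\<in>?S. Polynomial.order z (char_poly (kmat n a))) = (\<Sum>z\<in>?S. 1)"
    using order_peripheral by (intro sum.cong) (auto simp: spectrum_kmat)
  ultimately show ?thesis by simp
qed

end

section \<open>Cyclic classes\<close>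

lemma sum_roots_unity_power:
  fixes w :: complex
  assumes w: "w ^ L = 1" and t: "w ^ t \<noteq> 1"
  shows "(\<Sum>s<L. (w ^ s) ^ t) = 0"
proof -
  have "(\<Sum>s<L. (w ^ s) ^ t) = (\<Sum>s<L. (w ^ t) ^ s)"
    by (simp add: mult.commute flip: power_mult)
  also have "\<dots> = ((w ^ t) ^ L - 1) / (w ^ t - 1)" using t by (rule geometric_sum)
  also have "(w ^ t) ^ L = 1" using w by (metis mult.commute power_mult power_one)
  finally show ?thesis by simp
qed

definition unity_root :: "nat \<Rightarrow> complex" where
  "unity_root r = cis (2 * pi / real r)"

lemma unity_root_power: "unity_root r ^ s = cis (2 * pi * real s / real r)"
  by (simp add: unity_root_def DeMoivre mult.commute)

lemma norm_unity_root [simp]: "norm (unity_root r) = 1"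
  by (simp add: unity_root_def)

lemma unity_root_nz [simp]: "unity_root r \<noteq> 0"
  by (simp add: unity_root_def)

lemma unity_root_power_self: "0 < r \<Longrightarrow> unity_root r ^ r = 1"
  by (simp add: unity_root_power)

lemma unity_root_inj:
  assumes "s < r" "t < r" "unity_root r ^ s = unity_root r ^ t"
  shows "s = t"
proof -
  have "inj_on (\<lambda>k. cis (2 * pi * real k / real r)) {..<r}"
    using bij_betw_roots_unity[of r] assms(1) by (auto simp: bij_betw_def)
  then show ?thesis using assms by (auto simp: unity_root_power inj_on_def)
qed

lemma obtain_unity_root_power:
  assumes "0 < r" "z ^ r = 1"
  obtains s where "s < r" "z = unity_root r ^ s"
proof -
  have "z \<in> (\<lambda>k. cis (2 * pi * real k / real r)) ` {..<r}"
    using bij_betw_roots_unity[OF assms(1)] assms(2) by (auto simp: bij_betw_def)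
  then show ?thesis using that by (auto simp: unity_root_power)
qed

lemma unity_root_power_mod: "0 < r \<Longrightarrow> unity_root r ^ (s mod r) = unity_root r ^ s"
  by (metis mod_mult_div_eq mult.right_neutral power_add power_mult power_one unity_root_power_self)

section \<open>Decomposition along roots of unity and the resulting classes\<close>

context irreducible_kernel
begin

text \<open>As \<open>r\<close> divides \<open>card periph\<close>, \<open>unity_root r\<close> is a
  normalized peripheral eigenvalue. Its phase has \<open>d i ^ r\<close> constant along arcs,
  starting from 1.\<close>

lemma exists_phase:
  assumes "0 < r" "r dvd card periph"
  shows "\<exists>d. phase (unity_root r) d \<and> (\<forall>i<n. d i ^ r = 1)"
proof -
  have "unity_root r ^ card periph = 1"
    using assms unity_root_power_self[of r] by (metis dvdE power_mult power_one)
  then have "unity_root r \<in> periph" using periph_eq_roots_unity by blast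
  then obtain d where d: "phase (unity_root r) d" using periph_phase by blast
  have "d i ^ r = 1" if "i < n" for i
    using n_pos that
  proof (induction rule: path_induct)
    case base
    show ?case using d by (simp add: phase_def)
  next
    case (step u v)
    then have "d v = unity_root r * d u" using d by (simp add: phase_def)
    then show ?case using step assms by (simp add: power_mult_distrib unity_root_power_self)
  qed
  then show ?thesis using d by blast
qed

text \<open>The eigenspaces of \<open>A\<close> for the eigenvalues \<open>rho * \<zeta>\<close> with \<open>\<zeta> ^ r = 1\<close> consist of the
  multiples of \<open>d ^ s * pf\<close>.\<close>

lemma eigenspace_const_on_phase:
  fixes w :: complex and y :: "nat \<Rightarrow> complex"
  assumes d: "phase (unity_root r) d" and r: "0 < r" "w ^ r = 1"
    and y: "\<And>i. i < n \<Longrightarrow> T y i = rho * w * y i"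
    and ij: "i < n" "j < n" "d i = d j"
  shows "y i * pf j = y j * pf i"
proof (cases "\<exists>i<n. y i \<noteq> 0")
  case True
  obtain s where s: "w = unity_root r ^ s" using obtain_unity_root_power[OF r] by blast
  have "eigf n a (rho * w) y" using True y by (auto simp: eigf_def)
  moreover have "eigf n a (rho * w) (\<lambda>i. d i ^ s * of_real (pf i))"
    unfolding s by (intro phase_eigf phase_power d)
  moreover have "norm (rho * w) = rho" using rho_pos by (simp add: s norm_mult norm_power)
  ultimately obtain c where "\<forall>i<n. y i = c * (d i ^ s * of_real (pf i))"
    using peripheral_proportional by blast
  then show ?thesis using ij by simp
qed (use ij in auto)

text \<open>\<open>y s\<close> is, up to the factor \<open>L\<close>, the component of \<open>x\<close> in the eigenspace of \<open>A\<close> for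
  \<open>rho * unity_root L ^ s\<close>.\<close>

lemma pow_eig_const_on_phase:
  fixes x :: "nat \<Rightarrow> real"
  assumes x: "\<And>i. i < n \<Longrightarrow> (T ^^ L) x i = rho ^ L * x i" and L: "0 < L"
    and r: "r = gcd L (card periph)" and d: "phase (unity_root r) d"
    and ij: "i < n" "j < n" "d i = d j"
  shows "x i * pf j = x j * pf i"
proof -
  define w where "w = unity_root L"
  define X where "X = (\<lambda>i. complex_of_real (x i))"
  \<comment> \<open>\<open>c s\<close> inverts the eigenvalue with number \<open>s\<close>, so that
    \<open>T\<close> acts on the weighted sum \<open>y s\<close> as a cyclic shift times that
    eigenvalue.\<close>
  define c where "c = (\<lambda>s. inverse (rho * w ^ s))"
  define y where "y = (\<lambda>s i. \<Sum>t<L. c s ^ t * (T ^^ t) X i)"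
  have w: "w ^ L = 1" "norm w = 1" using L by (simp_all add: w_def unity_root_power_self)
  have c0: "rho * w ^ s * c s = 1" for s
    using rho_pos unfolding c_def by (intro right_inverse) (simp add: w_def)
  have wsL: "(w ^ s) ^ L = 1" for s using w by (metis mult.commute power_mult power_one)
  have TX: "(T ^^ L) X i = rho ^ L * X i" if "i < n" for i
    using x[OF that] by (simp add: X_def mv_pow_of_real)
  have Ty: "T (y s) i = rho * w ^ s * y s i" if i: "i < n" for s i
  proof -
    have "T (y s) i = (\<Sum>t<L. c s ^ t * (T ^^ Suc t) X i)"
      unfolding y_def by (simp add: mv_sum mv_mult)
    also have "\<dots> = rho * w ^ s * (\<Sum>t<L. c s ^ Suc t * (T ^^ Suc t) X i)"
      using c0[of s] by (simp add: sum_distrib_left mult.assoc[symmetric] del: funpow.simps)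
    \<comment> \<open>The shift drops the term \<open>t = 0\<close> and adds \<open>t = L\<close>;
      the two are equal because \<open>T ^^ L\<close> multiplies \<open>X\<close> by
      \<open>rho ^ L\<close>.\<close>
    also have "(\<Sum>t<L. c s ^ Suc t * (T ^^ Suc t) X i) =
        y s i + c s ^ L * (T ^^ L) X i - X i"
      unfolding y_def using sum.lessThan_Suc_shift[of "\<lambda>t. c s ^ t * (T ^^ t) X i" L]
      by (simp del: funpow.simps)
    also have "c s ^ L * (T ^^ L) X i = (rho * w ^ s * c s) ^ L * X i"
      by (simp add: TX[OF i] power_mult_distrib wsL)
    finally show ?thesis by (simp add: c0)
  qed
  \<comment> \<open>A nonzero component is an eigenvector, so \<open>w ^ s\<close> is both an
    \<open>L\<close>-th and a \<open>card periph\<close>-th root of unity, hence an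
    \<open>r\<close>-th one.\<close>
  have y: "y s i * pf j = y s j * pf i" for s
  proof (cases "\<exists>i<n. y s i \<noteq> 0")
    case True
    then have "eigf n a (rho * w ^ s) (y s)" using Ty by (auto simp: eigf_def)
    then have "w ^ s \<in> periph" unfolding periph_def using w(2) by (auto simp: norm_power)
    then have "(w ^ s) ^ card periph = 1" using periph_eq_roots_unity by blast
    then have "(w ^ s) ^ r = 1" unfolding r using wsL L by (intro power_gcd_eq_1)
    then show ?thesis
      using eigenspace_const_on_phase[OF d _ _ Ty ij] r L by simp
  qed (use ij in auto)
  \<comment> \<open>Fourier inversion: summing over all \<open>s\<close> kills every term with
    \<open>0 < t\<close> and counts the term \<open>t = 0\<close> exactly \<open>L\<close>
    times.\<close>
  have S: "of_nat L * X i = (\<Sum>s<L. y s i)" if "i < n" for i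
  proof -
    have "(\<Sum>s<L. y s i) = (\<Sum>t<L. (\<Sum>s<L. c s ^ t) * (T ^^ t) X i)"
      unfolding y_def by (subst sum.swap) (simp add: sum_distrib_right)
    also have "\<dots> = (\<Sum>t<L. if t = 0 then of_nat L * X i else 0)"
    proof (intro sum.cong refl)
      fix t assume t: "t \<in> {..<L}"
      have "(\<Sum>s<L. c s ^ t) = inverse (rho ^ t) * (\<Sum>s<L. (inverse w ^ s) ^ t)"
        by (simp add: c_def sum_distrib_left power_mult_distrib power_inverse)
      also have "\<dots> = 0" if "t \<noteq> 0"
      proof -
        have "w ^ t \<noteq> w ^ 0" using unity_root_inj[of t L 0] t L that by (auto simp: w_def)
        then have "inverse w ^ t \<noteq> 1" by (simp add: power_inverse)
        then have "(\<Sum>s<L. (inverse w ^ s) ^ t) = 0"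
          using w by (intro sum_roots_unity_power) (simp add: power_inverse)
        then show ?thesis by simp
      qed
      finally show "(\<Sum>s<L. c s ^ t) * (T ^^ t) X i = (if t = 0 then of_nat L * X i else 0)"
        by auto
    qed
    also have "\<dots> = of_nat L * X i" using L by simp
    finally show ?thesis ..
  qed
  have "of_nat L * X i * pf j = of_nat L * X j * pf i"
    unfolding S[OF ij(1)] S[OF ij(2)] sum_distrib_right using y by simp
  then have "X i * pf j = X j * pf i" using L by simp
  then show ?thesis by (simp add: X_def flip: of_real_mult)
qed

text \<open>All successors of an index share one phase, so \<open>x / pf\<close> is constant on them
  and any one successor determines \<open>T x i\<close>. Indices of equal phase have successors of
  equal phase.\<close>

lemma ratio_const_on_phase:
  fixes x :: "nat \<Rightarrow> real"
  assumes x: "\<And>i. i < n \<Longrightarrow> 0 < x i"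
    and eig: "\<And>i. i < n \<Longrightarrow> (T ^^ L) x i = rho ^ L * x i" and L: "0 < L"
    and r: "r = gcd L (card periph)" and d: "phase (unity_root r) d"
    and ij: "i < n" "j < n" "d i = d j"
  shows "T x i / x i = T x j / x j"
proof -
  note const = pow_eig_const_on_phase[OF eig L r d]
  have ratio: "T x i * pf v = rho * pf i * x v" if "i < n" "v < n" "0 < a i v" for i v
  proof -
    have "T x i * pf v = (\<Sum>u<n. a i u * (x u * pf v))"
      by (simp add: mv_def sum_distrib_right mult.assoc)
    also have "\<dots> = (\<Sum>u<n. a i u * (x v * pf u))"
    proof (intro sum.cong refl)
      fix u assume u: "u \<in> {..<n}"
      show "a i u * (x u * pf v) = a i u * (x v * pf u)"
      proof (cases "0 < a i u")
        case True
        then have "d u = d v" using d that u by (simp add: phase_def)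
        then show ?thesis using const[of u v] u that by simp
      qed (use nonneg[of i u] u that in auto)
    qed
    also have "\<dots> = T pf i * x v" by (simp add: mv_def sum_distrib_left mult_ac)
    finally show ?thesis using pf(1)[OF that(1)] by simp
  qed
  obtain u where u: "u < n" "0 < a i u" using row_pos ij by blast
  obtain v where v: "v < n" "0 < a j v" using row_pos ij by blast
  have "d u = d v" using d ij u v by (simp add: phase_def)
  then have uv: "x u * pf v = x v * pf u" using const u v by blast
  have xp: "x i * pf j = x j * pf i" using const ij by blast
  have ratio': "T x i / x i = rho * (pf i / x i) * (x v / pf v)" if "i < n" "v < n" "0 < a i v" for i v
  proof -
    have "T x i = rho * pf i * x v / pf v" using ratio[OF that] pf(2)[OF that(2)] by (simp add: field_simps)
    then show ?thesis by simp
  qed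
  have "T x i / x i = rho * (pf i / x i) * (x u / pf u)" using ratio'[OF ij(1) u] .
  also have "pf i / x i = pf j / x j"
    using xp x[OF ij(1)] x[OF ij(2)] by (simp add: field_simps)
  also have "x u / pf u = x v / pf v"
    using uv pf(2)[OF u(1)] pf(2)[OF v(1)] by (simp add: field_simps)
  also have "rho * (pf j / x j) * (x v / pf v) = T x j / x j" using ratio'[OF ij(2) v] ..
  finally show ?thesis .
qed

text \<open>The class of \<open>i\<close> is the exponent of its phase as a power of
  \<open>unity_root r\<close>; an arc multiplies the phase by \<open>unity_root r\<close> and so
  advances the class by one.\<close>

lemma exists_cyclic_classes:
  fixes x :: "nat \<Rightarrow> real"
  assumes x: "\<And>i. i < n \<Longrightarrow> 0 < x i"
    and eig: "\<And>i. i < n \<Longrightarrow> (T ^^ L) x i = rho ^ L * x i" and L: "0 < L"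
    and r: "r = gcd L (card periph)"
  shows "\<exists>cl. (\<forall>i<n. cl i < r) \<and> (\<forall>s<r. \<exists>i<n. cl i = s) \<and>
    (\<forall>i<n. \<forall>j<n. 0 < a i j \<longrightarrow> cl j = Suc (cl i) mod r) \<and>
    (\<forall>i<n. \<forall>j<n. cl i = cl j \<longrightarrow> T x i / x i = T x j / x j)"
proof -
  have r0: "0 < r" using r L by simp
  have "r dvd card periph" using r by simp
  then obtain d where d: "phase (unity_root r) d" and dr: "\<forall>i<n. d i ^ r = 1"
    using exists_phase[OF r0] by blast
  define cl where "cl = (\<lambda>i. SOME s. s < r \<and> d i = unity_root r ^ s)"
  have "cl i < r \<and> d i = unity_root r ^ cl i" if i: "i < n" for i
  proof -
    obtain s where "s < r" "d i = unity_root r ^ s"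
      using obtain_unity_root_power[OF r0 dr[rule_format, OF i]] .
    then show ?thesis
      unfolding cl_def using someI[of "\<lambda>s. s < r \<and> d i = unity_root r ^ s" s] by blast
  qed
  then have cl: "\<And>i. i < n \<Longrightarrow> cl i < r" "\<And>i. i < n \<Longrightarrow> d i = unity_root r ^ cl i" by blast+
  have arc: "cl j = Suc (cl i) mod r" if "i < n" "j < n" "0 < a i j" for i j
  proof (rule unity_root_inj[of _ r])
    have "unity_root r ^ cl j = unity_root r * unity_root r ^ cl i"
      using d that unfolding cl(2)[OF that(1), symmetric] cl(2)[OF that(2), symmetric]
      by (simp add: phase_def)
    then show "unity_root r ^ cl j = unity_root r ^ (Suc (cl i) mod r)"
      using r0 by (simp add: unity_root_power_mod)
  qed (use cl that r0 in auto)
  have cl0: "cl 0 = 0"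
    using unity_root_inj[of "cl 0" r 0] cl[OF n_pos] r0 d by (simp add: phase_def)
  \<comment> \<open>Following arcs from index 0, whose class is 0 because \<open>d 0 = 1\<close>,
    reaches the classes in order.\<close>
  have onto: "\<exists>i<n. cl i = s" if "s < r" for s
    using that
  proof (induction s)
    case 0
    show ?case using cl0 n_pos by blast
  next
    case (Suc s)
    then obtain i where i: "i < n" "cl i = s" by auto
    obtain j where j: "j < n" "0 < a i j" using row_pos[OF i(1)] by blast
    then have "cl j = Suc s" using arc[OF i(1) j] i Suc.prems by simp
    then show ?case using j by blast
  qed
  have "T x i / x i = T x j / x j" if "i < n" "j < n" "cl i = cl j" for i j
    using that by (intro ratio_const_on_phase[OF x eig L r d]) (simp_all add: cl(2))
  then show ?thesis
    using cl(1) arc onto by (intro exI[of _ cl] conjI allI impI)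
qed

end

section \<open>Arc ratios, iterates and class factors\<close>

context nonneg_kernel
begin

text \<open>Clearing denominators in the bound for each arc and summing over \<open>j\<close> with
  weights \<open>a i j\<close> gives the claim multiplied by \<open>T x i\<close>, which is then
  cancelled.\<close>

lemma T_pow_Suc_le:
  fixes x :: "nat \<Rightarrow> real"
  assumes x: "\<And>i. i < n \<Longrightarrow> 0 < x i" and Tx: "\<And>i. i < n \<Longrightarrow> 0 < T x i"
    and le: "\<And>i j. i < n \<Longrightarrow> j < n \<Longrightarrow> 0 < a i j \<Longrightarrow> T x i * (T ^^ N) x j / (x i * x j) \<le> M"
    and i: "i < n"
  shows "(T ^^ Suc N) x i \<le> M * x i"
proof -
  have "T x i * (T ^^ Suc N) x i = (\<Sum>j<n. a i j * (T x i * (T ^^ N) x j))"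
    by (simp add: mv_def sum_distrib_left mult_ac)
  also have "\<dots> \<le> (\<Sum>j<n. a i j * (M * (x i * x j)))"
  proof (rule sum_mono)
    fix j assume j: "j \<in> {..<n}"
    show "a i j * (T x i * (T ^^ N) x j) \<le> a i j * (M * (x i * x j))"
    proof (cases "0 < a i j")
      case True
      then show ?thesis using le[OF i, of j] x[OF i] x[of j] j by (simp add: pos_divide_le_eq)
    qed (use nonneg[OF i, of j] j in auto)
  qed
  also have "\<dots> = T x i * (M * x i)" by (simp add: mv_def sum_distrib_left mult_ac)
  finally show ?thesis using Tx[OF i] by simp
qed

lemma le_T_pow_Suc:
  fixes x :: "nat \<Rightarrow> real"
  assumes x: "\<And>i. i < n \<Longrightarrow> 0 < x i" and Tx: "\<And>i. i < n \<Longrightarrow> 0 < T x i"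
    and le: "\<And>i j. i < n \<Longrightarrow> j < n \<Longrightarrow> 0 < a i j \<Longrightarrow> M \<le> T x i * (T ^^ N) x j / (x i * x j)"
    and i: "i < n"
  shows "M * x i \<le> (T ^^ Suc N) x i"
proof -
  have "T x i * (M * x i) = (\<Sum>j<n. a i j * (M * (x i * x j)))"
    by (simp add: mv_def sum_distrib_left mult_ac)
  also have "\<dots> \<le> (\<Sum>j<n. a i j * (T x i * (T ^^ N) x j))"
  proof (rule sum_mono)
    fix j assume j: "j \<in> {..<n}"
    show "a i j * (M * (x i * x j)) \<le> a i j * (T x i * (T ^^ N) x j)"
    proof (cases "0 < a i j")
      case True
      then show ?thesis using le[OF i, of j] x[OF i] x[of j] j by (simp add: pos_le_divide_eq)
    qed (use nonneg[OF i, of j] j in auto)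
  qed
  also have "\<dots> = T x i * (T ^^ Suc N) x i" by (simp add: mv_def sum_distrib_left mult_ac)
  finally show ?thesis using Tx[OF i] by simp
qed

text \<open>All successors of \<open>i\<close> lie in the next class, so each further application of
  \<open>T\<close> contributes the factor of one more class.\<close>

lemma T_pow_cyclic:
  fixes x :: "nat \<Rightarrow> real"
  assumes arc: "\<And>i j. i < n \<Longrightarrow> j < n \<Longrightarrow> 0 < a i j \<Longrightarrow> cl j = Suc (cl i) mod r"
    and c: "\<And>i. i < n \<Longrightarrow> T x i = c (cl i mod r) * x i" and i: "i < n"
  shows "(T ^^ N) x i = (\<Prod>s<N. c ((cl i + s) mod r)) * (x i :: real)"
  using i
proof (induction N arbitrary: i)
  case (Suc N)
  have "(T ^^ Suc N) x i = T (\<lambda>j. (\<Prod>s<N. c ((cl j + s) mod r)) * x j) i"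
    using Suc.IH by (auto intro: mv_cong)
  also have "\<dots> = (\<Sum>j<n. a i j * (\<Prod>s<N. c ((cl j + s) mod r)) * x j)"
    by (simp add: mv_def mult.assoc)
  also have "\<dots> = (\<Sum>j<n. a i j * (\<Prod>s<N. c ((cl i + Suc s) mod r)) * x j)"
  proof (intro sum.cong refl)
    fix j assume j: "j \<in> {..<n}"
    have "(\<Prod>s<N. c ((cl j + s) mod r)) = (\<Prod>s<N. c ((cl i + Suc s) mod r))" if "0 < a i j"
      using arc[OF Suc.prems _ that] j by (simp add: mod_add_left_eq)
    then show "a i j * (\<Prod>s<N. c ((cl j + s) mod r)) * x j =
        a i j * (\<Prod>s<N. c ((cl i + Suc s) mod r)) * x j"
      using nonneg[OF Suc.prems, of j] j by (cases "0 < a i j") auto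
  qed
  also have "\<dots> = (\<Prod>s<N. c ((cl i + Suc s) mod r)) * T x i"
    by (simp add: mv_def sum_distrib_left sum_distrib_right mult_ac)
  also have "\<dots> = (\<Prod>s<Suc N. c ((cl i + s) mod r)) * x i"
    by (simp add: c[OF Suc.prems] prod.lessThan_Suc_shift del: prod.lessThan_Suc)
  finally show ?case .
qed simp

end

text \<open>Moving the window of length \<open>L\<close> by one exchanges two equal factors of an
  \<open>r\<close>-periodic sequence; nonzero factors permit the cancellation.\<close>

lemma cyclic_prod_const:
  fixes c :: "nat \<Rightarrow> real"
  assumes c: "\<And>s. s < r \<Longrightarrow> c s \<noteq> 0" and r: "0 < r" "r dvd L"
  shows "(\<Prod>s<L. c ((m + s) mod r)) = (\<Prod>s<L. c (s mod r))"
proof (induction m)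
  case (Suc m)
  have "c (m mod r) * (\<Prod>s<L. c ((Suc m + s) mod r)) = (\<Prod>s<Suc L. c ((m + s) mod r))"
    by (simp add: prod.lessThan_Suc_shift del: prod.lessThan_Suc)
  also have "\<dots> = (\<Prod>s<L. c ((m + s) mod r)) * c (m mod r)"
    using r(2) by (auto elim!: dvdE)
  finally show ?case using Suc c[of "m mod r"] r(1) by simp
qed simp

section \<open>Digraphs without sinks\<close>

locale sinkless_digraph = fin_digraph G for G :: "('a, 'b) pre_digraph" +
  fixes vs :: "'a list"
  assumes enum: "enumerates vs G" and vs: "1 \<le> length vs"
    and no_sink: "\<forall>u \<in> verts G. \<not> is_sink G u"
begin

abbreviation "n \<equiv> length vs"

definition a :: "nat \<Rightarrow> nat \<Rightarrow> real" where "a i j = real (adj_mat G vs $$ (i, j))"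

lemma kmat_a: "kmat n a = complex_adj_mat G vs"
  by (auto simp: kmat_def a_def adj_mat_def)

lemma nth_verts: "i < n \<Longrightarrow> vs ! i \<in> verts G"
  using enum nth_mem[of i vs] by (simp add: enumerates_def)

lemma verts_nth: "v \<in> verts G \<Longrightarrow> \<exists>i<n. v = vs ! i"
  using enum unfolding enumerates_def by (metis in_set_conv_nth)

lemma nth_inj: "i < n \<Longrightarrow> j < n \<Longrightarrow> vs ! i = vs ! j \<longleftrightarrow> i = j"
  using enum unfolding enumerates_def by (simp add: nth_eq_iff_index_eq)

lemma a_pos_iff:
  assumes "i < n" "j < n"
  shows "0 < a i j \<longleftrightarrow> (\<exists>e\<in>arcs G. tail G e = vs ! i \<and> head G e = vs ! j)"
proof -
  have "a i j = real (card {e \<in> arcs G. tail G e = vs ! i \<and> head G e = vs ! j})"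
    using assms by (simp add: a_def adj_mat_def)
  moreover have "finite {e \<in> arcs G. tail G e = vs ! i \<and> head G e = vs ! j}"
    using finite_arcs by simp
  ultimately have "0 < a i j \<longleftrightarrow> {e \<in> arcs G. tail G e = vs ! i \<and> head G e = vs ! j} \<noteq> {}"
    by (simp add: card_gt_0_iff)
  then show ?thesis by blast
qed

lemma a_pos_iff_dominates:
  assumes "i < n" "j < n"
  shows "0 < a i j \<longleftrightarrow> vs ! i \<rightarrow>\<^bsub>G\<^esub> vs ! j"
  unfolding a_pos_iff[OF assms] arcs_ends_conv image_iff Bex_def by fastforce

lemma exists_arc:
  assumes i: "i < n"
  shows "\<exists>j<n. 0 < a i j"
proof -
  obtain e where e: "e \<in> arcs G" "tail G e = vs ! i"
    using no_sink nth_verts[OF i] unfolding is_sink_def by blast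
  obtain j where j: "j < n" "head G e = vs ! j"
    using verts_nth[OF head_in_verts[OF e(1)]] by blast
  then have "0 < a i j" unfolding a_pos_iff[OF i j(1)] using e by blast
  then show ?thesis using j by blast
qed

sublocale nonneg_kernel n a
  using vs by unfold_locales (auto simp: a_def)

lemma rho_eq: "digraph_rho G vs = rho"
  by (simp add: digraph_rho_def rho_def kmat_a)

definition x :: "nat \<Rightarrow> nat \<Rightarrow> real" where "x k = (T ^^ k) (\<lambda>_. 1)"

lemma T_pow_x: "(T ^^ m) (x k) = x (k + m)"
  unfolding x_def by (subst add.commute) (simp only: funpow_add o_apply)

lemma T_x: "T (x k) = x (Suc k)"
  by (simp add: x_def)

lemma x_pos: "i < n \<Longrightarrow> 0 < x k i"
proof (induction k arbitrary: i)
  case (Suc k)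
  obtain j where "j < n" "0 < a i j" using exists_arc[OF Suc.prems] by blast
  moreover have "0 \<le> a i l *\<^sub>R x k l" if "l < n" for l
    using nonneg[OF Suc.prems that] Suc.IH[OF that] by simp
  ultimately have "0 < T (x k) i"
    unfolding mv_def using Suc.IH by (intro sum_pos2[of _ j]) simp_all
  then show ?case by (simp add: T_x)
qed (simp add: x_def)

text \<open>Row sums of a matrix power are its values on the all-ones vector; complex matrices link
  them to the iterates of \<open>T\<close> through \<open>kmat_pow_mult_vec\<close>.\<close>

lemma outdeg_eq:
  assumes i: "i < n"
  shows "real (outdeg G vs k i) = x k i"
proof -
  let ?A = "adj_mat G vs"
  have A: "?A \<in> carrier_mat n n" by (simp add: adj_mat_def)
  have Ak: "?A ^\<^sub>m k \<in> carrier_mat n n" using A by simp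
  have "complex_of_real (x k i) = (kmat n a ^\<^sub>m k *\<^sub>v vec n (\<lambda>_. complex_of_real 1)) $ i"
    using i by (simp only: kmat_pow_mult_vec mv_pow_of_real x_def index_vec)
  also have "kmat n a ^\<^sub>m k = map_mat of_nat (?A ^\<^sub>m k)"
    unfolding kmat_a by (rule semiring_hom.mat_hom_pow[OF _ A, symmetric]) (unfold_locales, simp_all)
  also have "(\<dots> *\<^sub>v vec n (\<lambda>_. complex_of_real 1)) $ i = of_nat (outdeg G vs k i)"
    using i carrier_matD[OF Ak]
    by (simp del: pow_mat_dim add: outdeg_def scalar_prod_def atLeast0LessThan)
  finally have "complex_of_real (x k i) = complex_of_real (real (outdeg G vs k i))" by simp
  then show ?thesis by (simp only: of_real_eq_iff)
qed

lemma average_outdegree_eq: "i < n \<Longrightarrow> average_outdegree G vs (k + 1) i = x (Suc k) i / x k i"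
  by (simp add: average_outdegree_def outdeg_eq)

text \<open>The radicand of \<open>arc_value\<close>, at which level arcs are compared with iterates
  of \<open>T\<close>.\<close>

definition arc_ratio :: "nat \<Rightarrow> nat \<Rightarrow> nat \<Rightarrow> nat \<Rightarrow> real" where
  "arc_ratio k N i j = x (Suc k) i * x (k + N) j / (x k i * x k j)"

lemma arc_value_eq:
  "i < n \<Longrightarrow> j < n \<Longrightarrow> arc_value G vs k N i j = arc_ratio k N i j powr (1 / real (N + 1))"
  by (simp add: arc_value_def outdeg_eq arc_ratio_def)

lemma arc_value_pow:
  assumes "i < n" "j < n"
  shows "arc_value G vs k N i j ^ Suc N = arc_ratio k N i j"
proof -
  have "0 < arc_ratio k N i j" using assms x_pos by (simp add: arc_ratio_def)
  then show ?thesis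
    using assms root_powr_inverse[of "Suc N"] real_root_pow_pos[of "Suc N"] by (simp add: arc_value_eq)
qed

lemma arc_values_eq:
  "arc_values G vs k N = {arc_value G vs k N i j |i j. i < n \<and> j < n \<and> 0 < a i j}"
  unfolding arc_values_def using a_pos_iff_dominates by blast

section \<open>Two-sided bound for the spectral radius\<close>

lemma finite_arc_values: "finite (arc_values G vs k N)"
proof (rule finite_subset)
  show "arc_values G vs k N \<subseteq> (\<lambda>(i, j). arc_value G vs k N i j) ` ({..<n} \<times> {..<n})"
    by (auto simp: arc_values_def)
qed simp

lemma arc_values_nonempty: "arc_values G vs k N \<noteq> {}"
  using exists_arc[OF n_pos] n_pos by (auto simp: arc_values_eq)

lemma arc_values_nonneg: "v \<in> arc_values G vs k N \<Longrightarrow> 0 \<le> v"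
  by (auto simp: arc_values_def arc_value_def)

lemma pow_le_Max:
  assumes "i < n"
  shows "(T ^^ Suc N) (x k) i \<le> Max (arc_values G vs k N) ^ Suc N * x k i"
proof (rule T_pow_Suc_le)
  fix i j assume ij: "i < n" "j < n" "0 < a i j"
  then have "arc_value G vs k N i j \<in> arc_values G vs k N" by (auto simp: arc_values_eq)
  then have "arc_value G vs k N i j ^ Suc N \<le> Max (arc_values G vs k N) ^ Suc N"
    using finite_arc_values arc_values_nonneg by (intro power_mono) auto
  then show "T (x k) i * (T ^^ N) (x k) j / (x k i * x k j) \<le> Max (arc_values G vs k N) ^ Suc N"
    unfolding arc_value_pow[OF ij(1,2)] by (simp add: arc_ratio_def T_x T_pow_x)
qed (use assms x_pos in \<open>auto simp: T_x\<close>)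

lemma Min_le_pow:
  assumes "i < n"
  shows "Min (arc_values G vs k N) ^ Suc N * x k i \<le> (T ^^ Suc N) (x k) i"
proof (rule le_T_pow_Suc)
  fix i j assume ij: "i < n" "j < n" "0 < a i j"
  then have "arc_value G vs k N i j \<in> arc_values G vs k N" by (auto simp: arc_values_eq)
  then have "Min (arc_values G vs k N) ^ Suc N \<le> arc_value G vs k N i j ^ Suc N"
    using finite_arc_values arc_values_nonneg arc_values_nonempty by (intro power_mono) auto
  then show "Min (arc_values G vs k N) ^ Suc N \<le> T (x k) i * (T ^^ N) (x k) j / (x k i * x k j)"
    unfolding arc_value_pow[OF ij(1,2)] by (simp add: arc_ratio_def T_x T_pow_x)
qed (use assms x_pos in \<open>auto simp: T_x\<close>)

lemma rho_le_Max: "rho \<le> Max (arc_values G vs k N)"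
proof -
  have "rho ^ Suc N \<le> Max (arc_values G vs k N) ^ Suc N"
    using x_pos pow_le_Max by (rule rho_pow_le)
  moreover have "0 \<le> Max (arc_values G vs k N)"
    using arc_values_nonneg Max_in[OF finite_arc_values arc_values_nonempty] by blast
  ultimately show ?thesis by (rule power_le_imp_le_base)
qed

lemma Min_le_rho: "Min (arc_values G vs k N) \<le> rho"
proof -
  have "Min (arc_values G vs k N) ^ Suc N \<le> rho ^ Suc N"
    using x_pos[THEN less_imp_le] n_pos x_pos[OF n_pos] Min_le_pow by (rule le_rho_pow)
  then show ?thesis using rho_nonneg by (rule power_le_imp_le_base)
qed

section \<open>The equality case\<close>

lemma cyclic_classes_imp_eq:
  assumes V: "cyclic_classes G r V" and r: "0 < r" "r dvd Suc N"
    and c: "\<And>j i. j \<in> {1..r} \<Longrightarrow> i < n \<Longrightarrow> vs ! i \<in> V j \<Longrightarrow> average_outdegree G vs (k + 1) i = c j"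
  shows "Min (arc_values G vs k N) = rho" "rho = Max (arc_values G vs k N)"
proof -
  have V_un: "(\<Union>j \<in> {1..r}. V j) = verts G"
    and V_arc: "\<And>e j. e \<in> arcs G \<Longrightarrow> j \<in> {1..r} \<Longrightarrow> tail G e \<in> V j \<Longrightarrow> head G e \<in> V (j mod r + 1)"
    and V_ne: "\<And>j. j \<in> {1..r} \<Longrightarrow> V j \<noteq> {}" and V_disj: "disjoint_family_on V {1..r}"
    using V unfolding cyclic_classes_def by auto
  have V_unique: "j = j'" if "j \<in> {1..r}" "j' \<in> {1..r}" "v \<in> V j" "v \<in> V j'" for j j' v
    using V_disj that unfolding disjoint_family_on_def by blast
  \<comment> \<open>Classes are numbered from 1 in \<open>cyclic_classes\<close> and from 0 in the
    modular arithmetic of \<open>cl\<close>, hence the \<open>Suc\<close>.\<close>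
  have "\<exists>s<r. vs ! i \<in> V (Suc s)" if i: "i < n" for i
  proof -
    obtain j where "j \<in> {1..r}" "vs ! i \<in> V j" using nth_verts[OF i] V_un by blast
    then show ?thesis by (intro exI[of _ "j - 1"]) auto
  qed
  then obtain cl where cl: "\<And>i. i < n \<Longrightarrow> cl i < r" "\<And>i. i < n \<Longrightarrow> vs ! i \<in> V (Suc (cl i))"
    by metis
  define g where "g = (\<lambda>s. c (Suc s))"
  have arc: "cl j = Suc (cl i) mod r" if ij: "i < n" "j < n" "0 < a i j" for i j
  proof -
    obtain e where e: "e \<in> arcs G" "tail G e = vs ! i" "head G e = vs ! j"
      using ij(3) unfolding a_pos_iff[OF ij(1,2)] by blast
    then have "vs ! j \<in> V (Suc (cl i) mod r + 1)"
      using V_arc[OF e(1), of "Suc (cl i)"] cl[OF ij(1)] by auto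
    moreover have "Suc (cl i) mod r + 1 \<in> {1..r}" using r(1) by (simp add: Suc_le_eq)
    moreover have "Suc (cl j) \<in> {1..r}" using cl(1)[OF ij(2)] by simp
    ultimately have "Suc (cl j) = Suc (cl i) mod r + 1" using V_unique cl(2)[OF ij(2)] by blast
    then show ?thesis by simp
  qed
  have g: "T (x k) i = g (cl i mod r) * x k i" if "i < n" for i
  proof -
    have "x (Suc k) i / x k i = c (Suc (cl i))"
      unfolding average_outdegree_eq[OF that, symmetric] using cl[OF that] that by (intro c) auto
    then show ?thesis
      using cl(1)[OF that] x_pos[OF that, of k] by (simp add: T_x g_def field_simps)
  qed
  \<comment> \<open>Every class is inhabited, so each factor is a quotient of positive
    outdegrees.\<close>
  have g0: "g s \<noteq> 0" if s: "s < r" for s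
  proof -
    obtain v where v: "v \<in> V (Suc s)" using V_ne[of "Suc s"] s by auto
    then have "v \<in> verts G" using V_un s by force
    then obtain i where i: "i < n" "v = vs ! i" using verts_nth by blast
    have "cl i = s" using V_unique[of "Suc (cl i)" "Suc s" v] v cl[OF i(1)] i that by auto
    then show ?thesis using g[OF i(1)] x_pos[OF i(1), of "Suc k"] that by (auto simp: T_x)
  qed
  \<comment> \<open>An arc ratio is the product of the factors of \<open>Suc N\<close> consecutive
    classes, beginning with that of the tail; as \<open>r\<close> divides \<open>Suc N\<close>, it
    does not depend on where it begins.\<close>
  define C where "C = (\<Prod>s<Suc N. g (s mod r))"
  have ratio: "arc_ratio k N i j = C" if ij: "i < n" "j < n" "0 < a i j" for i j
  proof -
    have "arc_ratio k N i j = g (cl i mod r) * (\<Prod>s<N. g ((cl j + s) mod r))"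
      using g[OF ij(1)] T_pow_cyclic[OF arc g ij(2), of N] x_pos[OF ij(1), of k] x_pos[OF ij(2), of k]
      by (simp add: arc_ratio_def T_x T_pow_x)
    also have "\<dots> = (\<Prod>s<Suc N. g ((cl i + s) mod r))"
      by (simp add: arc[OF ij] mod_add_left_eq prod.lessThan_Suc_shift del: prod.lessThan_Suc)
    also have "\<dots> = C" unfolding C_def using g0 r by (rule cyclic_prod_const)
    finally show ?thesis .
  qed
  \<comment> \<open>With a single arc value, minimum and maximum coincide and enclose
    \<open>rho\<close>.\<close>
  have "arc_values G vs k N \<subseteq> {C powr (1 / real (N + 1))}"
    using ratio by (auto simp: arc_values_eq arc_value_eq)
  then have "arc_values G vs k N = {C powr (1 / real (N + 1))}"
    using arc_values_nonempty by blast
  then show "Min (arc_values G vs k N) = rho" "rho = Max (arc_values G vs k N)"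
    using Min_le_rho[of k N] rho_le_Max[of k N] by auto
qed

text \<open>Carries walks between vertices over to indices, as required by
  \<open>irreducible_kernel\<close>.\<close>

lemma connected_indices:
  assumes "strongly_connected G" "i < n" "j < n"
  shows "(i, j) \<in> {(i, j). i < n \<and> j < n \<and> 0 < a i j}\<^sup>*"
proof -
  have "\<forall>l<n. vs ! l = w \<longrightarrow> (i, l) \<in> {(i, j). i < n \<and> j < n \<and> 0 < a i j}\<^sup>*"
    if "(vs ! i, w) \<in> rtrancl_on (verts G) (arcs_ends G)" for w
    using that
  proof (induction rule: rtrancl_on_induct)
    case base
    then show ?case using assms(2) by (simp add: nth_inj)
  next
    case (step y z)
    obtain l where l: "l < n" "vs ! l = y" using verts_nth step by blast
    show ?case
    proof (intro allI impI)
      fix m assume "m < n" "vs ! m = z"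
      then have "(l, m) \<in> {(i, j). i < n \<and> j < n \<and> 0 < a i j}" using l step a_pos_iff_dominates by simp
      moreover have "(i, l) \<in> {(i, j). i < n \<and> j < n \<and> 0 < a i j}\<^sup>*" using step l by blast
      ultimately show "(i, m) \<in> {(i, j). i < n \<and> j < n \<and> 0 < a i j}\<^sup>*" by (rule rtrancl_into_rtrancl[rotated])
    qed
  qed
  moreover have "vs ! i \<in> verts G" "vs ! j \<in> verts G" using nth_verts assms by blast+
  ultimately show ?thesis
    using assms unfolding strongly_connected_def reachable_def by blast
qed

text \<open>Equality on either side makes \<open>x k\<close> a sub- or supersolution at the exact
  value \<open>rho ^ Suc N\<close>, hence an eigenvector of \<open>T ^^ Suc N\<close>, and
  \<open>exists_cyclic_classes\<close> applies.\<close>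

lemma eq_imp_quasiregular:
  assumes sc: "strongly_connected G"
    and eq: "Min (arc_values G vs k N) = rho \<or> rho = Max (arc_values G vs k N)"
    and r: "r = gcd (N + 1) (imprimitivity_index G vs)"
  shows "average_outdegree_regular G vs (k + 1) \<or> average_outdegree_quasiregular G vs (k + 1) r"
proof -
  interpret irreducible_kernel n a
    by unfold_locales (use connected_indices[OF sc] exists_arc in auto)
  have h: "imprimitivity_index G vs = card periph"
    using sum_order_peripheral by (simp add: imprimitivity_index_def rho_eq kmat_a)
  have eig: "(T ^^ Suc N) (x k) i = rho ^ Suc N * x k i" if "i < n" for i
    using eq
  proof
    assume "Min (arc_values G vs k N) = rho"
    then have "rho ^ Suc N * x k i \<le> (T ^^ Suc N) (x k) i" if "i < n" for i
      using Min_le_pow[OF that, of k N] by simp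
    then show ?thesis using x_pos n_pos that by (intro subsolution_eq[of "x k" 0]) (auto intro: less_imp_le)
  next
    assume "rho = Max (arc_values G vs k N)"
    then have "(T ^^ Suc N) (x k) i \<le> rho ^ Suc N * x k i" if "i < n" for i
      using pow_le_Max[OF that, of N k] by simp
    then show ?thesis using x_pos that by (intro supersolution_eq) auto
  qed
  have r': "r = gcd (Suc N) (card periph)" using r h by simp
  have r0: "0 < r" using r by simp
  obtain cl where cl: "\<And>i. i < n \<Longrightarrow> cl i < r" "\<And>s. s < r \<Longrightarrow> \<exists>i<n. cl i = s"
    "\<And>i j. i < n \<Longrightarrow> j < n \<Longrightarrow> 0 < a i j \<Longrightarrow> cl j = Suc (cl i) mod r"
    "\<And>i j. i < n \<Longrightarrow> j < n \<Longrightarrow> cl i = cl j \<Longrightarrow> T (x k) i / x k i = T (x k) j / x k j"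
    using exists_cyclic_classes[OF x_pos eig zero_less_Suc r'] by blast
  have const: "average_outdegree G vs (k + 1) i = average_outdegree G vs (k + 1) j"
    if "i < n" "j < n" "cl i = cl j" for i j
    using cl(4)[OF that]
    unfolding average_outdegree_eq[OF that(1)] average_outdegree_eq[OF that(2)] T_x .
  show ?thesis
  \<comment> \<open>One class means a constant average outdegree; the quasiregular notion demands
    \<open>1 < r\<close>.\<close>
  proof (cases "r = 1")
    case True
    then have "average_outdegree G vs (k + 1) i = average_outdegree G vs (k + 1) 0" if "i < n" for i
      using const[OF that n_pos] cl(1)[OF that] cl(1)[OF n_pos] by simp
    then show ?thesis unfolding average_outdegree_regular_def by auto
  next
    case False
    define V where "V = (\<lambda>j. (!) vs ` {i. i < n \<and> Suc (cl i) = j})"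
    have "cyclic_classes G r V"
      unfolding cyclic_classes_def
    proof (intro conjI ballI impI)
      fix j assume j: "j \<in> {1..r}"
      then have "j - 1 < r" by auto
      then obtain i where "i < n" "cl i = j - 1" using cl(2) by blast
      then show "V j \<noteq> {}" using j by (auto simp: V_def)
    next
      show "disjoint_family_on V {1..r}"
        unfolding disjoint_family_on_def V_def using nth_inj by blast
      show "(\<Union>j \<in> {1..r}. V j) = verts G"
      proof
        show "(\<Union>j \<in> {1..r}. V j) \<subseteq> verts G" by (auto simp: V_def nth_verts)
        show "verts G \<subseteq> (\<Union>j \<in> {1..r}. V j)"
        proof
          fix v assume "v \<in> verts G"
          then obtain i where i: "i < n" "v = vs ! i" using verts_nth by blast
          then have "v \<in> V (Suc (cl i))" by (auto simp: V_def)
          then show "v \<in> (\<Union>j \<in> {1..r}. V j)" using cl(1)[OF i(1)] by auto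
        qed
      qed
    next
      fix e j assume e: "e \<in> arcs G" and "j \<in> {1..r}" "tail G e \<in> V j"
      then obtain i where i: "i < n" "tail G e = vs ! i" "Suc (cl i) = j" by (auto simp: V_def)
      obtain l where l: "l < n" "head G e = vs ! l"
        using verts_nth[OF head_in_verts[OF e]] by blast
      have "0 < a i l" unfolding a_pos_iff[OF i(1) l(1)] using e i l by blast
      from cl(3)[OF i(1) l(1) this] show "head G e \<in> V (j mod r + 1)" using i l by (auto simp: V_def)
    qed
    moreover have "\<exists>c. \<forall>j \<in> {1..r}. \<forall>i<n. vs ! i \<in> V j \<longrightarrow> average_outdegree G vs (k + 1) i = c j"
    proof (intro exI ballI allI impI)
      fix j i assume "j \<in> {1..r}" and i: "i < n" "vs ! i \<in> V j"
      then have clj: "Suc (cl i) = j" using nth_inj by (auto simp: V_def)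
      \<comment> \<open>The constant of class \<open>j\<close> is read off at a chosen member of the
        class.\<close>
      let ?P = "\<lambda>l. l < n \<and> Suc (cl l) = j"
      have "?P (SOME l. ?P l)" using someI[of ?P i] i clj by simp
      then show "average_outdegree G vs (k + 1) i = average_outdegree G vs (k + 1) (SOME l. l < n \<and> Suc (cl l) = j)"
        using const[OF i(1)] clj by auto
    qed
    moreover have "1 < r" using False r0 by linarith
    then have "cyclically_partite G vs r" using sc r by (simp add: cyclically_partite_def)
    ultimately show ?thesis unfolding average_outdegree_quasiregular_def by auto
  qed
qed

lemma regular_or_quasiregular_imp_eq:
  assumes P: "average_outdegree_regular G vs (k + 1) \<or> average_outdegree_quasiregular G vs (k + 1) r"
    and r: "r dvd N + 1"
  shows "Min (arc_values G vs k N) = rho \<and> rho = Max (arc_values G vs k N)"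
  using P
proof
  assume "average_outdegree_regular G vs (k + 1)"
  then obtain c where c: "\<And>i. i < n \<Longrightarrow> average_outdegree G vs (k + 1) i = c"
    by (auto simp: average_outdegree_regular_def)
  \<comment> \<open>Regularity is treated as the case of the single class of all vertices, since 1
    divides \<open>Suc N\<close>.\<close>
  have "cyclic_classes G 1 (\<lambda>_. verts G)"
    using nth_verts[OF n_pos] by (auto simp: cyclic_classes_def disjoint_family_on_def)
  from cyclic_classes_imp_eq[OF this, of N k "\<lambda>_. c"] c show ?thesis by simp
next
  assume "average_outdegree_quasiregular G vs (k + 1) r"
  then obtain V c where "cyclic_classes G r V" "1 < r"
    "\<And>j i. j \<in> {1..r} \<Longrightarrow> i < n \<Longrightarrow> vs ! i \<in> V j \<Longrightarrow> average_outdegree G vs (k + 1) i = c j"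
    unfolding average_outdegree_quasiregular_def cyclically_partite_def by blast
  with r show ?thesis using cyclic_classes_imp_eq[of r V N k c] by simp
qed

end

theorem theorem17:
  fixes G :: "('a, 'b) pre_digraph" and vs :: "'a list" and N k :: nat
  assumes "fin_digraph G"
    and "enumerates vs G"
    and "length vs \<ge> 1"
    and "\<forall>u \<in> verts G. \<not> is_sink G u"
  shows "Min (arc_values G vs k N) \<le> digraph_rho G vs \<and>
         digraph_rho G vs \<le> Max (arc_values G vs k N) \<and>
         (strongly_connected G \<longrightarrow>
            (let r = gcd (N + 1) (imprimitivity_index G vs);
                 P = average_outdegree_regular G vs (k + 1) \<or>
                     average_outdegree_quasiregular G vs (k + 1) r
             in (Min (arc_values G vs k N) = digraph_rho G vs \<longleftrightarrow> P) \<and>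
                (digraph_rho G vs = Max (arc_values G vs k N) \<longleftrightarrow> P)))"
proof -
  interpret fin_digraph G by fact
  interpret sinkless_digraph G vs by unfold_locales fact+
  show ?thesis
    unfolding rho_eq Let_def
    using Min_le_rho rho_le_Max eq_imp_quasiregular regular_or_quasiregular_imp_eq[OF _ gcd_dvd1] by blast
qed

end
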